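(* Let $m,n>-1/2$ and $0\le|\beta_i|<\alpha_i$, $i=1,2$. Suppose $X\sim\mathrm{VG}(m,\alpha_1,\beta_1,0)$ and $Y\sim\mathrm{VG}(n,\alpha_2,\beta_2,0)$ are independent, and let $Z=X/Y$. Then the probability density function $f_Z$ of $Z$ is given, for $z\in\mathbb{R}\setminus\{0\}$, by \begin{align*} f_Z(z) &= \frac{\gamma_1^{2m+1}\gamma_2^{2n+1}|z|^{-2n-2}}{\pi\alpha_1^{2m+2n+2}\Gamma(m+1/2)\Gamma(n+1/2)} \sum^\infty_{i,j=0} \frac{\beta_1^i\beta_2^j}{i!\,j!}\, \frac{2^{i+j} a_{ij}\,((i+j)/2)!\,z^{-j}}{\alpha_1^{i+j}\,\Gamma(m+n+2+i+j)}\\ &\quad\times \Gamma\Big(m+n+1+\frac{i+j}{2}\Big)\Gamma\Big(m+1+\frac{i+j}{2}\Big)\Gamma\Big(n+1+\frac{i+j}{2}\Big)\\ &\quad\times {}_2F_1\bigg(m+n+1+\frac{i+j}{2},\,n+1+\frac{i+j}{2};\,m+n+2+i+j;\,1-\frac{\alpha_2^2}{\alpha_1^2z^2}\bigg). \end{align*}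
   Context: For $m>-1/2$ and $0\le|\beta|<\alpha$, a random variable $X$ has the variance-gamma distribution $\mathrm{VG}(m,\alpha,\beta,0)$ if it has probability density function $$f_X(x)=\frac{\gamma^{2m+1}}{\sqrt{\pi}(2\alpha)^m\Gamma(m+1/2)}\,\mathrm{e}^{\beta x}|x|^mK_m(\alpha|x|),\quad x\in\mathbb{R},\qquad \gamma^2=\alpha^2-\beta^2,\ \gamma>0,$$ where $K_m(x)=\int_0^\infty \mathrm{e}^{-x\cosh t}\cosh(mt)\,\mathrm{d}t$, $x>0$, is the modified Bessel function of the second kind. Notation: $\gamma_i=\sqrt{\alpha_i^2-\beta_i^2}$, $i=1,2$. For integers $i,j\ge0$, $a_{ij}=(1+(-1)^{i+j})/2$, so $a_{ij}=1$ if $i+j$ is even and $a_{ij}=0$ if $i+j$ is odd. Throughout $x!=\Gamma(x+1)$. ${}_2F_1(a,b;c;x)=\sum_{k=0}^\infty\frac{(a)_k(b)_k}{(c)_k}\frac{x^k}{k!}$ for $|x|<1$, with $(u)_k=u(u+1)\cdots(u+k-1)$, extended by analytic continuation (to $\mathbb{C}\setminus[1,\infty)$). The density of the ratio is the version $f_Z(z)=\int_{-\infty}^\infty|y|f_X(yz)f_Y(y)\,\mathrm{d}y$. *)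

theory Defs
  imports "HOL-Probability.Probability" "HOL-Complex_Analysis.Complex_Analysis"
begin

text \<open>Only meaningful for \<open>x > 0\<close>: otherwise the integral diverges and evaluates to \<open>0\<close>.\<close>

definition besselK :: "real \<Rightarrow> real \<Rightarrow> real" where
  "besselK m x = (LINT t:{0..}|lborel. exp (- x * cosh t) * cosh (m * t))"

text \<open>
  Density of \<open>VG(m, \<alpha>, \<beta>, 0)\<close>. At the single point \<open>x = 0\<close> the formula is to be read as a
  (possibly infinite) limit, whereas here the value is \<open>0\<close>; this changes neither the distribution
  nor the ratio density below at any \<open>z \<noteq> 0\<close>.
\<close>

definition vg_density :: "real \<Rightarrow> real \<Rightarrow> real \<Rightarrow> real \<Rightarrow> real" where
  "vg_density m \<alpha> \<beta> x =
     sqrt (\<alpha>\<^sup>2 - \<beta>\<^sup>2) powr (2 * m + 1) / (sqrt pi * (2 * \<alpha>) powr m * Gamma (m + 1/2))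
     * exp (\<beta> * x) * \<bar>x\<bar> powr m * besselK m (\<alpha> * \<bar>x\<bar>)"

definition vg_distributed ::
    "'a measure \<Rightarrow> ('a \<Rightarrow> real) \<Rightarrow> real \<Rightarrow> real \<Rightarrow> real \<Rightarrow> bool" where
  "vg_distributed M X m \<alpha> \<beta> \<longleftrightarrow> distributed M lborel X (\<lambda>x. ennreal (vg_density m \<alpha> \<beta> x))"

definition ratio_density :: "(real \<Rightarrow> real) \<Rightarrow> (real \<Rightarrow> real) \<Rightarrow> real \<Rightarrow> real" where
  "ratio_density f g z = (LINT y|lborel. \<bar>y\<bar> * f (y * z) * g y)"

text \<open>
  The principal branch of Gauss' hypergeometric function: the value at \<open>z\<close> of the holomorphic
  function on the plane cut along \<open>[1, \<infinity>)\<close> that equals the hypergeometric series on the unit disc.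
  The cut plane is connected, so there is at most one such function. The value carries no
  meaning on the cut or when \<open>c\<close> is a nonpositive integer.
\<close>

definition hyp2F1 :: "complex \<Rightarrow> complex \<Rightarrow> complex \<Rightarrow> complex \<Rightarrow> complex" where
  "hyp2F1 a b c z = (THE w. \<exists>F. F holomorphic_on (- (complex_of_real ` {1..})) \<and>
     (\<forall>u. norm u < 1 \<longrightarrow>
        (\<lambda>k. pochhammer a k * pochhammer b k / pochhammer c k * (u ^ k / fact k)) sums F u) \<and>
     w = F z)"

definition parity_coeff :: "nat \<Rightarrow> nat \<Rightarrow> real" where
  "parity_coeff i j = (1 + (-1) ^ (i + j)) / 2"

definition real_fact :: "real \<Rightarrow> real" where
  "real_fact x = Gamma (x + 1)"

end

theory Submission
  imports Defs
begin

text \<open>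
  Expanding \<open>exp ((\<beta>\<^sub>1 z + \<beta>\<^sub>2) y)\<close> in the ratio density leaves the moments of a product of two Bessel
  functions; the odd ones vanish by symmetry. Writing each
  \<open>K\<^sub>m (a x)\<close> as \<open>(2 a / x)\<^sup>m / 2\<close> times the integral of \<open>p\<^sup>m\<^sup>-\<^sup>1 exp (- a\<^sup>2 p - x\<^sup>2 / (4 p))\<close> over \<open>p > 0\<close>, the
  \<open>x\<close>-integral becomes a Gamma integral, and after \<open>p = r (1 - t)\<close>, \<open>q = r t\<close> so does the
  \<open>r\<close>-integral. What remains is Euler's integral in \<open>t\<close>, which continues the hypergeometric series to
  the cut plane. All integrands are nonnegative, so Tonelli's theorem suffices. Summation and
  integration may be exchanged because \<open>exp (\<theta> x) K\<^sub>m x \<le> K\<^sub>m ((1 - \<theta>) x)\<close> for \<open>0 \<le> \<theta> < 1\<close>.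
\<close>

subsection \<open>Substitutions and Gamma integrals\<close>

text \<open>The argument \<open>1 - \<alpha>\<^sub>2\<^sup>2 / (\<alpha>\<^sub>1\<^sup>2 *
  z\<^sup>2)\<close> is always below 1 but tends to minus infinity as z tends to 0, so the
  hypergeometric series alone covers only part of the range. Since \<open>hyp2F1\<close> is
  specified by the uniqueness of a continuation, one has to be exhibited: Euler's integral is
  expanded in a power series around every centre of the cut plane, and the expansion at 0 is the
  hypergeometric one. The moments depend on z only through a =
  \<open>\<alpha>\<^sub>1 * \<bar>z\<bar>\<close>, with b = \<open>\<alpha>\<^sub>2\<close>; the
  base a^2 (1 - t) + b^2 t left by the r-integral equals a^2 (1 - (1 - b^2/a^2) t), which is the
  origin of the argument. For the moment of order s the two Gamma integrals have exponents 1 + s/2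
  and m + n + 1 + s/2, positive because m + n > -1 even when m or n is negative. Finiteness is read
  off from computed values, so the calculations stay in \<open>ennreal\<close> and return to the
  reals afterwards.\<close>

lemma nn_integral_exp_substitution:
  fixes f :: "real \<Rightarrow> ennreal"
  assumes [measurable]: "f \<in> borel_measurable borel"
  shows "(\<integral>\<^sup>+x. f x * indicator {0<..} x \<partial>lborel) = (\<integral>\<^sup>+t. f (exp t) * ennreal (exp t) \<partial>lborel)"
proof -
  \<comment> \<open>The map \<open>exp\<close> carries \<open>B n\<close> onto \<open>A n\<close>,
    so substitution on compact intervals applies for each n, and continuity of measures from below
    gives the limit. \<open>Suc n\<close> keeps every interval nondegenerate.\<close>
  define A :: "nat \<Rightarrow> real set" where "A n = {exp (- real (Suc n))..exp (real (Suc n))}" for n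
  define B :: "nat \<Rightarrow> real set" where "B n = {- real (Suc n)..real (Suc n)}" for n
  have "incseq A" "incseq B"
    by (auto simp: incseq_def A_def B_def intro: order_trans[rotated] order_trans)
  have UA: "(\<Union>n. A n) = {0<..}"
  proof (intro set_eqI iffI)
    fix x :: real assume "x \<in> {0<..}"
    obtain n :: nat where n: "\<bar>ln x\<bar> \<le> real n" using real_arch_simple by blast
    have "x = exp (ln x)" using \<open>x \<in> _\<close> by simp
    moreover have "exp (- real (Suc n)) \<le> exp (ln x)" "exp (ln x) \<le> exp (real (Suc n))"
      using n by (subst exp_le_cancel_iff, linarith)+
    ultimately show "x \<in> (\<Union>n. A n)" by (auto simp: A_def intro!: exI[of _ n])
  next
    fix x :: real assume "x \<in> (\<Union>n. A n)"
    then obtain n where "exp (- real (Suc n)) \<le> x" by (auto simp: A_def)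
    then show "x \<in> {0<..}" using exp_gt_zero[of "- real (Suc n)"] by (simp del: exp_gt_zero)
  qed
  have UB: "(\<Union>n. B n) = UNIV"
  proof (intro set_eqI iffI UNIV_I)
    fix x :: real
    obtain n :: nat where n: "\<bar>x\<bar> \<le> real n" using real_arch_simple by blast
    then show "x \<in> (\<Union>n. B n)" by (auto simp: B_def intro!: exI[of _ n])
  qed
  have "(\<integral>\<^sup>+x. f x * indicator {0<..} x \<partial>lborel) = emeasure (density lborel f) (\<Union>n. A n)"
    unfolding UA by (subst emeasure_density) auto
  also have "\<dots> = (SUP n. emeasure (density lborel f) (A n))"
    by (rule SUP_emeasure_incseq[symmetric, OF _ \<open>incseq A\<close>]) (auto simp: A_def)
  also have "\<dots> = (SUP n. emeasure (density lborel (\<lambda>t. f (exp t) * ennreal (exp t))) (B n))"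
  proof (intro SUP_cong refl)
    fix n
    have "emeasure (density lborel f) (A n) = (\<integral>\<^sup>+x. f x * indicator (A n) x \<partial>lborel)"
      by (subst emeasure_density) (auto simp: A_def)
    also have "\<dots> = (\<integral>\<^sup>+t. f (exp t) * ennreal (exp t) * indicator (B n) t \<partial>lborel)"
      unfolding A_def B_def
      by (intro nn_integral_substitution_aux[where g' = exp])
         (auto intro!: derivative_eq_intros continuous_intros)
    also have "\<dots> = emeasure (density lborel (\<lambda>t. f (exp t) * ennreal (exp t))) (B n)"
      by (subst emeasure_density) (auto simp: B_def)
    finally show "emeasure (density lborel f) (A n) = \<dots>" .
  qed
  also have "\<dots> = emeasure (density lborel (\<lambda>t. f (exp t) * ennreal (exp t))) (\<Union>n. B n)"
    by (rule SUP_emeasure_incseq[OF _ \<open>incseq B\<close>]) (auto simp: B_def)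
  also have "\<dots> = (\<integral>\<^sup>+t. f (exp t) * ennreal (exp t) \<partial>lborel)"
    unfolding UB by (subst emeasure_density) auto
  finally show ?thesis .
qed

lemma nn_integral_powr_exp_scaled:
  fixes w A :: real
  assumes "w > 0" "A > 0"
  shows "(\<integral>\<^sup>+r. ennreal (r powr (w - 1) * exp (- A * r)) * indicator {0<..} r \<partial>lborel)
    = ennreal (Gamma w * A powr (- w))"
proof -
  let ?I = "\<integral>\<^sup>+r. ennreal (r powr (w - 1) * exp (- A * r)) * indicator {0<..} r \<partial>lborel"
  have "ennreal (Gamma w) = (\<integral>\<^sup>+ t. ennreal (indicator {0..} t * t powr (w - 1) / exp t) \<partial>lborel)"
    using assms by (rule_tac Gamma_conv_nn_integral_real)
  also have "\<dots> = \<bar>A\<bar> * (\<integral>\<^sup>+ t. ennreal (indicator {0..} (0 + A * t) * (0 + A * t) powr (w - 1) / exp (0 + A * t)) \<partial>lborel)"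
    using assms by (intro nn_integral_real_affine) auto
  also have "(\<integral>\<^sup>+ t. ennreal (indicator {0..} (0 + A * t) * (0 + A * t) powr (w - 1) / exp (0 + A * t)) \<partial>lborel)
     = (\<integral>\<^sup>+ t. ennreal (A powr (w - 1)) * (ennreal (t powr (w - 1) * exp (- A * t)) * indicator {0<..} t) \<partial>lborel)"
    using assms
    by (intro nn_integral_cong)
       (auto simp: indicator_def powr_mult exp_minus field_simps zero_le_mult_iff ennreal_mult'[symmetric])
  also have "\<dots> = ennreal (A powr (w - 1)) * ?I" by (rule nn_integral_cmult) auto
  also have "ennreal \<bar>A\<bar> * (ennreal (A powr (w - 1)) * ?I) = ennreal (A powr w) * ?I"
    using assms by (simp add: mult.assoc[symmetric] ennreal_mult[symmetric] powr_diff)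
  finally have eq: "ennreal (Gamma w) = ennreal (A powr w) * ?I" .
  \<comment> \<open>Multiplying by the inverse power avoids cancelling in \<open>ennreal\<close>,
    where \<open>?I\<close> is not yet known to be finite.\<close>
  have "ennreal (Gamma w * A powr (- w)) = ennreal (A powr (- w)) * (ennreal (A powr w) * ?I)"
    unfolding eq[symmetric] using assms
    by (simp add: ennreal_mult[symmetric] Gamma_real_pos less_imp_le mult.commute)
  also have "\<dots> = ?I"
    using assms by (simp add: mult.assoc[symmetric] ennreal_mult[symmetric] powr_add[symmetric])
  finally show ?thesis by simp
qed

text \<open>In logarithmic coordinates the squaring x^2 = r becomes a doubling of t. The
  substitution is then affine and contributes the factor 1/2.\<close>

lemma nn_integral_powr_exp_square:
  fixes w A :: real
  assumes "w > 0" "A > 0"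
  shows "(\<integral>\<^sup>+x. ennreal (x powr (2 * w - 1) * exp (- A * x\<^sup>2)) * indicator {0<..} x \<partial>lborel)
    = ennreal (Gamma w * A powr (- w) / 2)"
proof -
  let ?I = "\<integral>\<^sup>+t. ennreal (exp (2 * w * t) * exp (- A * exp (2 * t))) \<partial>lborel"
  have "(\<integral>\<^sup>+x. ennreal (x powr (2 * w - 1) * exp (- A * x\<^sup>2)) * indicator {0<..} x \<partial>lborel) =
    (\<integral>\<^sup>+t. ennreal (exp t powr (2 * w - 1) * exp (- A * (exp t)\<^sup>2)) * ennreal (exp t) \<partial>lborel)"
    by (rule nn_integral_exp_substitution) auto
  also have "\<dots> = ?I"
    by (intro nn_integral_cong)
       (auto simp: ennreal_mult[symmetric] powr_def exp_double[symmetric] mult_exp_exp algebra_simps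
             simp flip: exp_of_nat2_mult)
  finally have 1: "(\<integral>\<^sup>+x. ennreal (x powr (2 * w - 1) * exp (- A * x\<^sup>2)) * indicator {0<..} x \<partial>lborel) = ?I" .
  have "ennreal (Gamma w * A powr (- w)) =
     (\<integral>\<^sup>+r. ennreal (r powr (w - 1) * exp (- A * r)) * indicator {0<..} r \<partial>lborel)"
    using nn_integral_powr_exp_scaled[OF assms] by simp
  also have "\<dots> = (\<integral>\<^sup>+t. ennreal (exp t powr (w - 1) * exp (- A * exp t)) * ennreal (exp t) \<partial>lborel)"
    by (rule nn_integral_exp_substitution) auto
  also have "\<dots> = (\<integral>\<^sup>+t. ennreal (exp (w * t) * exp (- A * exp t)) \<partial>lborel)"
    by (intro nn_integral_cong)
       (auto simp: ennreal_mult[symmetric] powr_def mult_exp_exp algebra_simps)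
  also have "\<dots> = ennreal \<bar>2\<bar> * (\<integral>\<^sup>+t. ennreal (exp (w * (0 + 2 * t)) * exp (- A * exp (0 + 2 * t))) \<partial>lborel)"
    by (rule nn_integral_real_affine) auto
  also have "\<dots> = 2 * ?I" by (simp add: mult.assoc mult.left_commute)
  finally have 2: "ennreal (Gamma w * A powr (- w)) = 2 * ?I" .
  have "ennreal (Gamma w * A powr (- w) / 2) = ennreal (1/2) * ennreal (Gamma w * A powr (- w))"
    by (subst ennreal_mult[symmetric]) (auto simp: assms Gamma_real_pos less_imp_le)
  also have "\<dots> = ennreal (1/2) * ennreal 2 * ?I" unfolding 2 by (simp add: mult.assoc)
  also have "\<dots> = ?I" by (subst ennreal_mult[symmetric]) auto
  finally show ?thesis using 1 by simp
qed

text \<open>The planar change of variables p = r (1 - t), q = r t with Jacobian r splits into two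
  affine ones in a single variable: the translation p = r - q for fixed q, then, after Tonelli, the
  scaling q = r t for fixed r.\<close>

lemma nn_integral_quadrant_eq_simplex:
  fixes g :: "real \<Rightarrow> real \<Rightarrow> ennreal"
  assumes [measurable]: "case_prod g \<in> borel_measurable (borel \<Otimes>\<^sub>M borel)"
  shows "(\<integral>\<^sup>+p. (\<integral>\<^sup>+q. g p q * indicator {0<..} q \<partial>lborel) * indicator {0<..} p \<partial>lborel) =
    (\<integral>\<^sup>+r. (\<integral>\<^sup>+t. g (r * (1 - t)) (r * t) * indicator {0<..<1} t \<partial>lborel) * (ennreal r * indicator {0<..} r) \<partial>lborel)"
proof -
  have "(\<integral>\<^sup>+p. (\<integral>\<^sup>+q. g p q * indicator {0<..} q \<partial>lborel) * indicator {0<..} p \<partial>lborel) =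
        (\<integral>\<^sup>+p. \<integral>\<^sup>+q. g p q * indicator {0<..} q * indicator {0<..} p \<partial>lborel \<partial>lborel)"
    by (simp add: nn_integral_multc)
  also have "\<dots> = (\<integral>\<^sup>+q. \<integral>\<^sup>+p. g p q * indicator {0<..} q * indicator {0<..} p \<partial>lborel \<partial>lborel)"
    by (rule lborel_pair.Fubini') auto
  also have "\<dots> = (\<integral>\<^sup>+q. \<integral>\<^sup>+r. g (r - q) q * indicator {0<..} q * indicator {0<..} (r - q) \<partial>lborel \<partial>lborel)"
  proof (rule nn_integral_cong)
    fix q :: real
    show "(\<integral>\<^sup>+p. g p q * indicator {0<..} q * indicator {0<..} p \<partial>lborel) =
      (\<integral>\<^sup>+r. g (r - q) q * indicator {0<..} q * indicator {0<..} (r - q) \<partial>lborel)"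
      using nn_integral_real_affine[where c = 1 and t = "-q"
          and f = "\<lambda>p. g p q * indicator {0<..} q * indicator {0<..} p"] by simp
  qed
  also have "\<dots> = (\<integral>\<^sup>+r. \<integral>\<^sup>+q. g (r - q) q * indicator {0<..} q * indicator {0<..} (r - q) \<partial>lborel \<partial>lborel)"
    by (rule lborel_pair.Fubini') auto
  also have "\<dots> = (\<integral>\<^sup>+r. (\<integral>\<^sup>+t. g (r * (1 - t)) (r * t) * indicator {0<..<1} t \<partial>lborel) * (ennreal r * indicator {0<..} r) \<partial>lborel)"
  proof (rule nn_integral_cong)
    fix r :: real
    show "(\<integral>\<^sup>+q. g (r - q) q * indicator {0<..} q * indicator {0<..} (r - q) \<partial>lborel) =
      (\<integral>\<^sup>+t. g (r * (1 - t)) (r * t) * indicator {0<..<1} t \<partial>lborel) * (ennreal r * indicator {0<..} r)"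
    proof (cases "r > 0")
      case False
      then have "(\<integral>\<^sup>+q. g (r - q) q * indicator {0<..} q * indicator {0<..} (r - q) \<partial>lborel) = (\<integral>\<^sup>+q. 0 \<partial>(lborel :: real measure))"
        by (intro nn_integral_cong) (auto simp: indicator_def)
      with False show ?thesis by simp
    next
      case True
      have "(\<integral>\<^sup>+q. g (r - q) q * indicator {0<..} q * indicator {0<..} (r - q) \<partial>lborel)
        = \<bar>r\<bar> * (\<integral>\<^sup>+t. g (r - (0 + r * t)) (0 + r * t) * indicator {0<..} (0 + r * t) * indicator {0<..} (r - (0 + r * t)) \<partial>lborel)"
        using True by (intro nn_integral_real_affine) auto
      also have "(\<integral>\<^sup>+t. g (r - (0 + r * t)) (0 + r * t) * indicator {0<..} (0 + r * t) * indicator {0<..} (r - (0 + r * t)) \<partial>lborel)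
        = (\<integral>\<^sup>+t. g (r * (1 - t)) (r * t) * indicator {0<..<1} t \<partial>lborel)"
        using True
        by (intro nn_integral_cong) (auto simp: indicator_def algebra_simps zero_less_mult_iff)
      finally show ?thesis using True by (simp add: mult.commute)
    qed
  qed
  finally show ?thesis .
qed

lemma nn_integral_fold_at_0:
  fixes f :: "real \<Rightarrow> ennreal"
  assumes [measurable]: "f \<in> borel_measurable borel"
  shows "(\<integral>\<^sup>+t. f t \<partial>lborel) = (\<integral>\<^sup>+t. (f t + f (- t)) * indicator {0<..} t \<partial>lborel)"
proof -
  have "(\<integral>\<^sup>+t. f t \<partial>lborel) = (\<integral>\<^sup>+t. f t * indicator {0<..} t + f t * indicator {..<0} t \<partial>lborel)"
    by (rule nn_integral_cong_AE, rule AE_mp[OF AE_lborel_singleton[of 0]]) (auto simp: indicator_def)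
  also have "\<dots> = (\<integral>\<^sup>+t. f t * indicator {0<..} t \<partial>lborel) + (\<integral>\<^sup>+t. f t * indicator {..<0} t \<partial>lborel)"
    by (rule nn_integral_add) auto
  also have "(\<integral>\<^sup>+t. f t * indicator {..<0} t \<partial>lborel) = (\<integral>\<^sup>+t. f (-t) * indicator {0<..} t \<partial>lborel)"
    using nn_integral_real_affine[where c = "-1" and t = 0 and f = "\<lambda>t. f t * indicator {..<0} t"]
    by (simp add: indicator_def)
  also have "(\<integral>\<^sup>+t. f t * indicator {0<..} t \<partial>lborel) + (\<integral>\<^sup>+t. f (-t) * indicator {0<..} t \<partial>lborel)
      = (\<integral>\<^sup>+t. f t * indicator {0<..} t + f (-t) * indicator {0<..} t \<partial>lborel)"
    by (rule nn_integral_add[symmetric]) auto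
  finally show ?thesis by (simp add: ring_distribs)
qed

subsection \<open>The modified Bessel function\<close>

text \<open>An \<open>ennreal\<close> copy of \<open>besselK\<close>, to which Tonelli applies with
  no integrability condition. The two agree for x > 0 once finiteness is known, see
  \<open>ennreal_besselK\<close>.\<close>

definition besselK_nn :: "real \<Rightarrow> real \<Rightarrow> ennreal" where
  "besselK_nn m x = (\<integral>\<^sup>+t. ennreal (exp (- x * cosh t) * cosh (m * t)) * indicator {0..} t \<partial>lborel)"

lemma measurable_besselK [measurable]: "besselK m \<in> borel_measurable borel"
  unfolding besselK_def set_lebesgue_integral_def
  by (rule sigma_finite_measure.borel_measurable_lebesgue_integral)
     (auto simp: sigma_finite_lborel cosh_def)

lemma besselK_nonneg: "besselK m x \<ge> 0"
  unfolding besselK_def set_lebesgue_integral_def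
  by (intro integral_nonneg_AE AE_I2) (auto simp: indicator_def)

text \<open>\<open>cosh (m * t)\<close> is the even part of exp (m t), and the other factor is even.
  An integral over the whole line can be translated, which the next lemma relies on.\<close>

lemma besselK_nn_eq_full_line:
  "besselK_nn m x = (\<integral>\<^sup>+t. ennreal (exp (m * t - x * cosh t) / 2) \<partial>lborel)"
proof -
  let ?f = "\<lambda>t. ennreal (exp (m * t - x * cosh t) / 2)"
  have [measurable]: "(\<lambda>t::real. cosh t) \<in> borel_measurable borel"
    unfolding cosh_def by measurable
  have "(\<integral>\<^sup>+t. ?f t \<partial>lborel) = (\<integral>\<^sup>+t. (?f t + ?f (- t)) * indicator {0<..} t \<partial>lborel)"
    by (rule nn_integral_fold_at_0) auto
  also have "\<dots> = besselK_nn m x"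
    unfolding besselK_nn_def
  proof (rule nn_integral_cong_AE, rule AE_mp[OF AE_lborel_singleton[of 0]], intro AE_I2 impI)
    fix t :: real assume "t \<noteq> 0"
    have "exp (m * t - c) / 2 + exp (m * (- t) - c) / 2 = exp (- c) * cosh (m * t)" for c
      unfolding cosh_field_def[of "m * t"] by (simp add: exp_diff exp_minus field_simps)
    from this[of "x * cosh t"]
    show "(?f t + ?f (- t)) * indicator {0<..} t =
      ennreal (exp (- x * cosh t) * cosh (m * t)) * indicator {0..} t"
      using \<open>t \<noteq> 0\<close> by (auto simp: indicator_def ennreal_plus[symmetric] simp del: ennreal_plus)
  qed
  finally show ?thesis by simp
qed

lemma besselK_nn_eq_heat_kernel:
  fixes a x m :: real
  assumes "a > 0" "x > 0"
  shows "besselK_nn m (a * x) = ennreal ((2 * a / x) powr m / 2) *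
    (\<integral>\<^sup>+p. ennreal (p powr (m - 1) * exp (- (a\<^sup>2 * p) - x\<^sup>2 / (4 * p))) * indicator {0<..} p \<partial>lborel)"
    (is "_ = ?c * ?I")
proof -
  have [measurable]: "(\<lambda>t::real. cosh t) \<in> borel_measurable borel"
    unfolding cosh_def by measurable
  \<comment> \<open>The shift amounts to p = x exp t / (2 a). It balances the exponent: a^2 p and
    x^2 / (4 p) become a x exp t / 2 and a x exp (- t) / 2, with sum a x cosh t.\<close>
  define l where "l = ln (x / (2 * a))"
  have el: "exp l = x / (2 * a)" "exp (- l) = 2 * a / x"
    using assms by (auto simp: l_def exp_minus)
  have "?I = (\<integral>\<^sup>+s. ennreal (exp s powr (m - 1) * exp (- (a\<^sup>2 * exp s) - x\<^sup>2 / (4 * exp s))) * ennreal (exp s) \<partial>lborel)"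
    by (rule nn_integral_exp_substitution) auto
  also have "\<dots> = (\<integral>\<^sup>+s. ennreal (exp (m * s) * exp (- (a\<^sup>2 * exp s) - x\<^sup>2 / (4 * exp s))) \<partial>lborel)"
    by (intro nn_integral_cong)
       (auto simp: ennreal_mult[symmetric] powr_def mult_exp_exp algebra_simps)
  also have "\<dots> = (\<integral>\<^sup>+t. ennreal (exp (m * (l + t)) * exp (- (a\<^sup>2 * exp (l + t)) - x\<^sup>2 / (4 * exp (l + t)))) \<partial>lborel)"
    using nn_integral_real_affine[where c = 1 and t = l and
       f = "\<lambda>s. ennreal (exp (m * s) * exp (- (a\<^sup>2 * exp s) - x\<^sup>2 / (4 * exp s)))"] by simp
  also have "\<dots> = (\<integral>\<^sup>+t. ennreal (2 * (x / (2 * a)) powr m) * ennreal (exp (m * t - (a * x) * cosh t) / 2) \<partial>lborel)"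
  proof (rule nn_integral_cong)
    fix t
    have 1: "exp (m * (l + t)) = (x / (2 * a)) powr m * exp (m * t)"
      using assms by (simp add: powr_def l_def exp_add[symmetric] algebra_simps)
    have 2: "- (a\<^sup>2 * exp (l + t)) - x\<^sup>2 / (4 * exp (l + t)) = - ((a * x) * cosh t)"
      unfolding exp_add el cosh_def using assms
      by (simp add: exp_minus field_simps power2_eq_square)
    show "ennreal (exp (m * (l + t)) * exp (- (a\<^sup>2 * exp (l + t)) - x\<^sup>2 / (4 * exp (l + t))))
      = ennreal (2 * (x / (2 * a)) powr m) * ennreal (exp (m * t - (a * x) * cosh t) / 2)"
      unfolding 1 2 by (subst ennreal_mult[symmetric]) (auto simp: exp_diff exp_minus field_simps)
  qed
  also have "\<dots> = ennreal (2 * (x / (2 * a)) powr m) * besselK_nn m (a * x)"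
    unfolding besselK_nn_eq_full_line by (rule nn_integral_cmult) auto
  finally have "?c * ?I = ?c * ennreal (2 * (x / (2 * a)) powr m) * besselK_nn m (a * x)"
    by (simp add: mult.assoc)
  also have "?c * ennreal (2 * (x / (2 * a)) powr m) = 1"
    using assms by (subst ennreal_mult[symmetric]) (auto simp: powr_mult[symmetric])
  finally show ?thesis by simp
qed

lemma besselK_nn_finite:
  assumes "x > 0"
  shows "besselK_nn m x < \<infinity>"
proof -
  \<comment> \<open>K grows with the absolute value of its order, so m may be replaced by a larger
    order. A positive order makes p^(k-1) integrable at 0, and the factor exp (- x^2 / (4 p)) can
    simply be bounded by 1.\<close>
  define k where "k = \<bar>m\<bar> + 1"
  have "k > 0" by (simp add: k_def)
  have "cosh (m * t) \<le> cosh (k * t)" if "t \<ge> 0" for t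
  proof -
    have "\<bar>m * t\<bar> \<le> k * t" using that by (auto simp: k_def abs_mult algebra_simps)
    then have "cosh \<bar>m * t\<bar> \<le> cosh (k * t)"
      by (intro cosh_real_nonneg_le_iff[THEN iffD2]) auto
    then show ?thesis by simp
  qed
  then have "besselK_nn m x \<le> besselK_nn k x"
    unfolding besselK_nn_def
    by (intro nn_integral_mono) (auto simp: indicator_def intro!: ennreal_leI)
  also have "besselK_nn k x = besselK_nn k (1 * x)" by simp
  also have "\<dots> = ennreal ((2 * 1 / x) powr k / 2) *
    (\<integral>\<^sup>+p. ennreal (p powr (k - 1) * exp (- (1\<^sup>2 * p) - x\<^sup>2 / (4 * p))) * indicator {0<..} p \<partial>lborel)"
    by (rule besselK_nn_eq_heat_kernel) (use assms in auto)
  also have "\<dots> \<le> ennreal ((2 * 1 / x) powr k / 2) *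
    (\<integral>\<^sup>+p. ennreal (p powr (k - 1) * exp (- 1 * p)) * indicator {0<..} p \<partial>lborel)"
    by (intro mult_left_mono nn_integral_mono) (auto simp: indicator_def intro!: ennreal_leI mult_left_mono)
  also have "\<dots> = ennreal ((2 * 1 / x) powr k / 2) * ennreal (Gamma k * 1 powr (- k))"
    by (subst nn_integral_powr_exp_scaled) (use \<open>k > 0\<close> in auto)
  also have "\<dots> < \<infinity>" by (simp add: ennreal_mult_less_top)
  finally show ?thesis .
qed

lemma ennreal_besselK:
  assumes "x > 0"
  shows "ennreal (besselK m x) = besselK_nn m x"
proof -
  have [measurable]: "(\<lambda>t::real. cosh t) \<in> borel_measurable borel"
    unfolding cosh_def by measurable
  have eq: "besselK_nn m x = (\<integral>\<^sup>+t. ennreal (indicator {0..} t *\<^sub>R (exp (- x * cosh t) * cosh (m * t))) \<partial>lborel)"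
    unfolding besselK_nn_def by (intro nn_integral_cong) (auto simp: indicator_def)
  have "besselK m x = enn2real (besselK_nn m x)"
    unfolding besselK_def set_lebesgue_integral_def eq
    by (rule integral_eq_nn_integral) (auto simp: indicator_def)
  then show ?thesis using besselK_nn_finite[OF assms, of m] by simp
qed

text \<open>Under the integral sign, cosh t >= 1 lets \<theta> x be replaced by \<theta> x cosh t,
  which merges with the exponent - x cosh t.\<close>

lemma exp_mult_besselK_le:
  assumes "0 \<le> \<theta>" "\<theta> < 1" "x > 0"
  shows "exp (\<theta> * x) * besselK m x \<le> besselK m ((1 - \<theta>) * x)"
proof -
  have [measurable]: "(\<lambda>t::real. cosh t) \<in> borel_measurable borel"
    unfolding cosh_def by measurable
  have "ennreal (exp (\<theta> * x) * besselK m x) = ennreal (exp (\<theta> * x)) * besselK_nn m x"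
    using assms by (simp add: ennreal_mult besselK_nonneg ennreal_besselK)
  also have "\<dots> = (\<integral>\<^sup>+t. ennreal (exp (\<theta> * x)) * (ennreal (exp (- x * cosh t) * cosh (m * t)) * indicator {0..} t) \<partial>lborel)"
    unfolding besselK_nn_def by (rule nn_integral_cmult[symmetric]) auto
  also have "\<dots> \<le> besselK_nn m ((1 - \<theta>) * x)"
    unfolding besselK_nn_def
  proof (rule nn_integral_mono)
    fix t :: real
    have "\<theta> * x * 1 \<le> \<theta> * x * cosh t"
      using assms by (intro mult_left_mono cosh_real_ge_1) auto
    then have "exp (\<theta> * x) * exp (- x * cosh t) \<le> exp (- ((1 - \<theta>) * x) * cosh t)"
      unfolding mult_exp_exp by (simp add: algebra_simps)
    then have "exp (\<theta> * x) * exp (- x * cosh t) * cosh (m * t) \<le> exp (- ((1 - \<theta>) * x) * cosh t) * cosh (m * t)"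
      by (rule mult_right_mono) auto
    then show "ennreal (exp (\<theta> * x)) * (ennreal (exp (- x * cosh t) * cosh (m * t)) * indicator {0..} t)
       \<le> ennreal (exp (- ((1 - \<theta>) * x) * cosh t) * cosh (m * t)) * indicator {0..} t"
      by (auto simp: indicator_def ennreal_mult[symmetric] mult.assoc intro!: ennreal_leI)
  qed
  also have "\<dots> = ennreal (besselK m ((1 - \<theta>) * x))"
    using assms by (intro ennreal_besselK[symmetric]) auto
  finally show ?thesis using besselK_nonneg by (simp add: ennreal_le_iff)
qed

text \<open>The two positivity conditions on s are the convergence conditions of the Gamma integrals
  in x and in r, whose values are the two Gamma factors in front.\<close>

lemma nn_integral_besselK_mult_besselK:
  fixes a b m n s :: real
  assumes ab: "a > 0" "b > 0" and T: "1 + s / 2 > 0" and R: "m + n + 1 + s / 2 > 0"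
  shows "(\<integral>\<^sup>+x. ennreal (x powr (m + n + 1 + s) * besselK m (a * x) * besselK n (b * x)) * indicator {0<..} x \<partial>lborel)
    = ennreal (2 powr (m + n + s - 1) * a powr m * b powr n * Gamma (1 + s / 2) * Gamma (m + n + 1 + s / 2)) *
      (\<integral>\<^sup>+t. ennreal ((1 - t) powr (m + s / 2) * t powr (n + s / 2) *
         (a\<^sup>2 * (1 - t) + b\<^sup>2 * t) powr (- (m + n + 1 + s / 2))) * indicator {0<..<1} t \<partial>lborel)"
proof -
  define T where "T = 1 + s / 2"
  define R where "R = m + n + 1 + s / 2"
  have [simp]: "T > 0" "R > 0" using assms by (auto simp: T_def R_def)
  \<comment> \<open>The constants of the two heat-kernel formulas: (2a)^m/2 times (2b)^n/2. Their
    factor x^(-m-n) reduces the power of x to 1 + s = 2 T - 1.\<close>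
  define c where "c = 2 powr (m + n - 2) * a powr m * b powr n"
  have c0: "c \<ge> 0" by (simp add: c_def)
  define f where "f a m x p = ennreal (p powr (m - 1) * exp (- (a\<^sup>2 * p) - x\<^sup>2 / (4 * p))) * indicator {0<..} p"
    for a m x p :: real
  define F where "F x p q = ennreal (x powr (2 * T - 1)) * (f a m x p * f b n x q) * indicator {0<..} x" for x p q :: real
  have mf [measurable]: "(\<lambda>(x, p). f a m x p) \<in> borel_measurable (borel \<Otimes>\<^sub>M borel)" for a m
    unfolding f_def by measurable
  \<comment> \<open>Stated for composed arguments, so that measurability is found whichever of the
    three variables is being integrated after a swap.\<close>
  have mF [measurable (raw)]: "(\<lambda>w. F (u w) (v w) (k w)) \<in> borel_measurable N"
    if [measurable]: "u \<in> borel_measurable N" "v \<in> borel_measurable N" "k \<in> borel_measurable N"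
    for u v k and N :: "'z measure"
    unfolding F_def f_def by measurable
  \<comment> \<open>What the x-integral of \<open>F\<close> leaves, up to the constant
    \<open>Gamma T * 4 powr T / 2\<close>; \<open>h\<close> below is \<open>g\<close> in the
    coordinates r, t with its Jacobian, arranged as a Gamma integrand in r times a function of
    t.\<close>
  define g where "g p q = ennreal (p powr (m - 1) * q powr (n - 1) * (p * q / (p + q)) powr T * exp (- (a\<^sup>2 * p) - b\<^sup>2 * q))"
    for p q :: real
  have mg [measurable]: "case_prod g \<in> borel_measurable (borel \<Otimes>\<^sub>M borel)"
    unfolding g_def by measurable
  define h where "h r t = ennreal (r powr (R - 1) * exp (- (a\<^sup>2 * (1 - t) + b\<^sup>2 * t) * r)) * indicator {0<..} r *
     (ennreal ((1 - t) powr (m + s / 2) * t powr (n + s / 2)) * indicator {0<..<1} t)" for r t :: real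
  have [measurable]: "case_prod h \<in> borel_measurable (borel \<Otimes>\<^sub>M borel)"
    unfolding h_def by measurable
  have A_pos: "a\<^sup>2 * (1 - t) + b\<^sup>2 * t > 0" if "0 < t" "t < 1" for t
    using that ab by (intro add_pos_pos mult_pos_pos) auto
  have "(\<integral>\<^sup>+x. ennreal (x powr (m + n + 1 + s) * besselK m (a * x) * besselK n (b * x)) * indicator {0<..} x \<partial>lborel)
    = (\<integral>\<^sup>+x. ennreal c * (\<integral>\<^sup>+p. \<integral>\<^sup>+q. F x p q \<partial>lborel \<partial>lborel) \<partial>lborel)"
  proof (rule nn_integral_cong)
    fix x :: real
    show "ennreal (x powr (m + n + 1 + s) * besselK m (a * x) * besselK n (b * x)) * indicator {0<..} x
      = ennreal c * (\<integral>\<^sup>+p. \<integral>\<^sup>+q. F x p q \<partial>lborel \<partial>lborel)"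
    proof (cases "x > 0")
      case False
      then show ?thesis by (simp add: F_def)
    next
      case True
      have "(\<integral>\<^sup>+p. \<integral>\<^sup>+q. F x p q \<partial>lborel \<partial>lborel) =
          ennreal (x powr (2 * T - 1)) * ((\<integral>\<^sup>+p. f a m x p \<partial>lborel) * (\<integral>\<^sup>+q. f b n x q \<partial>lborel))"
        using True by (simp add: F_def nn_integral_cmult nn_integral_multc)
      moreover have "x powr (m + n + 1 + s) * ((2 * a / x) powr m / 2) * ((2 * b / x) powr n / 2) =
          c * x powr (2 * T - 1)"
      proof -
        have 1: "x powr (m + n + 1 + s) = x powr m * x powr n * x powr (2 * T - 1)"
          by (simp add: powr_add[symmetric] T_def add_ac)
        have 2: "(2 :: real) powr (m + n - 2) = 2 powr m * 2 powr n / 4"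
          by (simp add: powr_add powr_diff)
        show ?thesis
          unfolding 1 c_def 2 using True ab by (simp add: powr_divide powr_mult field_simps)
      qed
      moreover have "ennreal (x powr (m + n + 1 + s) * besselK m (a * x) * besselK n (b * x)) =
         ennreal (x powr (m + n + 1 + s)) * besselK_nn m (a * x) * besselK_nn n (b * x)"
        using True ab by (simp add: ennreal_mult besselK_nonneg ennreal_besselK)
      moreover have "besselK_nn m (a * x) = ennreal ((2 * a / x) powr m / 2) * (\<integral>\<^sup>+p. f a m x p \<partial>lborel)"
        unfolding f_def by (rule besselK_nn_eq_heat_kernel) (use True ab in auto)
      moreover have "besselK_nn n (b * x) = ennreal ((2 * b / x) powr n / 2) * (\<integral>\<^sup>+p. f b n x p \<partial>lborel)"
        unfolding f_def by (rule besselK_nn_eq_heat_kernel) (use True ab in auto)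
      moreover have "ennreal u * (ennreal v * I) * (ennreal w * J) = ennreal c * (ennreal k * (I * J))"
        if "u * v * w = c * k" "u \<ge> 0" "v \<ge> 0" "w \<ge> 0" "k \<ge> 0" for u v w k I J
      proof -
        have "ennreal u * (ennreal v * I) * (ennreal w * J) = (ennreal u * ennreal v * ennreal w) * (I * J)"
          by (simp only: mult_ac)
        also have "ennreal u * ennreal v * ennreal w = ennreal c * ennreal k"
          using that c0 by (simp add: ennreal_mult[symmetric])
        finally show ?thesis by (simp only: mult.assoc)
      qed
      ultimately show ?thesis
        using True by simp
    qed
  qed
  also have "\<dots> = ennreal c * (\<integral>\<^sup>+x. \<integral>\<^sup>+p. \<integral>\<^sup>+q. F x p q \<partial>lborel \<partial>lborel \<partial>lborel)"
    by (rule nn_integral_cmult) measurable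
  also have "(\<integral>\<^sup>+x. \<integral>\<^sup>+p. \<integral>\<^sup>+q. F x p q \<partial>lborel \<partial>lborel \<partial>lborel) = (\<integral>\<^sup>+p. \<integral>\<^sup>+x. \<integral>\<^sup>+q. F x p q \<partial>lborel \<partial>lborel \<partial>lborel)"
    by (rule lborel_pair.Fubini') measurable
  also have "\<dots> = (\<integral>\<^sup>+p. \<integral>\<^sup>+q. \<integral>\<^sup>+x. F x p q \<partial>lborel \<partial>lborel \<partial>lborel)"
    by (intro nn_integral_cong lborel_pair.Fubini') measurable
  also have "\<dots> = (\<integral>\<^sup>+p. (\<integral>\<^sup>+q. (ennreal (Gamma T * 4 powr T / 2) * g p q) * indicator {0<..} q \<partial>lborel) * indicator {0<..} p \<partial>lborel)"
  proof (rule nn_integral_cong)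
    fix p :: real
    have "(\<integral>\<^sup>+x. F x p q \<partial>lborel) = ennreal (Gamma T * 4 powr T / 2) * g p q * indicator {0<..} q * indicator {0<..} p" for q
    proof (cases "p > 0 \<and> q > 0")
      case False
      then show ?thesis by (auto simp: F_def f_def)
    next
      case True
      \<comment> \<open>The Gaussian rates 1/(4p) and 1/(4q) add up. The inverse of their sum is 4 p
        q / (p + q), hence the harmonic factor in \<open>g\<close>.\<close>
      define A where "A = (1 / p + 1 / q) / 4"
      have "A > 0" using True by (simp add: A_def add_pos_pos)
      have "(\<integral>\<^sup>+x. F x p q \<partial>lborel) =
         (\<integral>\<^sup>+x. ennreal (p powr (m - 1) * q powr (n - 1) * exp (- (a\<^sup>2 * p) - b\<^sup>2 * q)) *
           (ennreal (x powr (2 * T - 1) * exp (- A * x\<^sup>2)) * indicator {0<..} x) \<partial>lborel)"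
      proof (rule nn_integral_cong)
        fix x
        have "exp (- (a\<^sup>2 * p) - x\<^sup>2 / (4 * p)) * exp (- (b\<^sup>2 * q) - x\<^sup>2 / (4 * q))
          = exp (- (a\<^sup>2 * p) - b\<^sup>2 * q) * exp (- A * x\<^sup>2)"
          unfolding mult_exp_exp A_def by (simp add: algebra_simps add_divide_distrib)
        then have "x powr (2 * T - 1) * ((p powr (m - 1) * exp (- (a\<^sup>2 * p) - x\<^sup>2 / (4 * p))) *
           (q powr (n - 1) * exp (- (b\<^sup>2 * q) - x\<^sup>2 / (4 * q)))) =
          (p powr (m - 1) * q powr (n - 1) * exp (- (a\<^sup>2 * p) - b\<^sup>2 * q)) * (x powr (2 * T - 1) * exp (- A * x\<^sup>2))"
          by (simp add: mult_ac)
        then show "F x p q = ennreal (p powr (m - 1) * q powr (n - 1) * exp (- (a\<^sup>2 * p) - b\<^sup>2 * q)) *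
           (ennreal (x powr (2 * T - 1) * exp (- A * x\<^sup>2)) * indicator {0<..} x)"
          using True unfolding F_def f_def by (auto simp: ennreal_mult[symmetric] indicator_def)
      qed
      also have "\<dots> = ennreal (p powr (m - 1) * q powr (n - 1) * exp (- (a\<^sup>2 * p) - b\<^sup>2 * q)) *
          ennreal (Gamma T * A powr (- T) / 2)"
        using nn_integral_powr_exp_square[OF \<open>T > 0\<close> \<open>A > 0\<close>]
        by (subst nn_integral_cmult) auto
      also have "A powr (- T) = 4 powr T * (p * q / (p + q)) powr T"
      proof -
        have "A = inverse (4 * (p * q / (p + q)))"
          using True by (simp add: A_def field_simps)
        then have "A powr (- T) = (4 * (p * q / (p + q))) powr T"
          using True by (simp only: powr_minus inverse_powr inverse_inverse_eq)
        also have "\<dots> = 4 powr T * (p * q / (p + q)) powr T"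
          using True by (intro powr_mult)
        finally show ?thesis .
      qed
      finally show ?thesis
        using True by (simp add: g_def ennreal_mult[symmetric] Gamma_real_pos less_imp_le mult_ac)
    qed
    then show "(\<integral>\<^sup>+q. \<integral>\<^sup>+x. F x p q \<partial>lborel \<partial>lborel) =
      (\<integral>\<^sup>+q. (ennreal (Gamma T * 4 powr T / 2) * g p q) * indicator {0<..} q \<partial>lborel) * indicator {0<..} p"
      by (simp add: nn_integral_multc)
  qed
  also have "\<dots> = (\<integral>\<^sup>+r. (\<integral>\<^sup>+t. (ennreal (Gamma T * 4 powr T / 2) * g (r * (1 - t)) (r * t)) * indicator {0<..<1} t \<partial>lborel) *
      (ennreal r * indicator {0<..} r) \<partial>lborel)"
    by (rule nn_integral_quadrant_eq_simplex) measurable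
  also have "\<dots> = (\<integral>\<^sup>+r. \<integral>\<^sup>+t. ennreal (Gamma T * 4 powr T / 2) * h r t \<partial>lborel \<partial>lborel)"
  proof (rule nn_integral_cong)
    fix r :: real
    have "g (r * (1 - t)) (r * t) * indicator {0<..<1} t * (ennreal r * indicator {0<..} r) = h r t" for t
    proof (cases "r > 0 \<and> 0 < t \<and> t < 1")
      case False
      then show ?thesis by (auto simp: h_def)
    next
      case True
      define u where "u = 1 - t"
      have u: "u > 0" "r > 0" "t > 0" using True by (auto simp: u_def)
      \<comment> \<open>Since p + q = r, the harmonic factor is homogeneous of degree 1 in r. The
        powers of r then collect to (m - 1) + (n - 1) + T + 1 = R - 1, the final 1 being the
        Jacobian.\<close>
      have harm: "r * u * (r * t) / (r * u + r * t) = r * (u * t)"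
        using True by (simp add: u_def field_simps)
      have r_pow: "r powr (m - 1) * r powr (n - 1) * r powr T * r powr 1 = r powr (R - 1)"
        unfolding powr_add[symmetric] by (rule arg_cong[where f = "\<lambda>e. r powr e"]) (simp add: R_def T_def)
      have u_pow: "u powr (m - 1) * u powr T = u powr (m + s / 2)"
        unfolding powr_add[symmetric] by (rule arg_cong[where f = "\<lambda>e. u powr e"]) (simp add: T_def)
      have t_pow: "t powr (n - 1) * t powr T = t powr (n + s / 2)"
        unfolding powr_add[symmetric] by (rule arg_cong[where f = "\<lambda>e. t powr e"]) (simp add: T_def)
      have "(r * u) powr (m - 1) * (r * t) powr (n - 1) * (r * (u * t)) powr T * r
        = (r powr (m - 1) * r powr (n - 1) * r powr T * r powr 1) *
          ((u powr (m - 1) * u powr T) * (t powr (n - 1) * t powr T))"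
        using u by (simp add: powr_mult mult_ac)
      then have "(r * (1 - t)) powr (m - 1) * (r * t) powr (n - 1) * (r * (1 - t) * (r * t) / (r * (1 - t) + r * t)) powr T * r
        = r powr (R - 1) * ((1 - t) powr (m + s / 2) * t powr (n + s / 2))"
        unfolding u_def[symmetric] harm r_pow u_pow t_pow .
      moreover have "exp (- (a\<^sup>2 * (r * (1 - t))) - b\<^sup>2 * (r * t)) = exp (- (a\<^sup>2 * (1 - t) + b\<^sup>2 * t) * r)"
        by (simp add: algebra_simps)
      ultimately have "(r * (1 - t)) powr (m - 1) * (r * t) powr (n - 1) * (r * (1 - t) * (r * t) / (r * (1 - t) + r * t)) powr T
           * exp (- (a\<^sup>2 * (r * (1 - t))) - b\<^sup>2 * (r * t)) * r =
         r powr (R - 1) * exp (- (a\<^sup>2 * (1 - t) + b\<^sup>2 * t) * r) * ((1 - t) powr (m + s / 2) * t powr (n + s / 2))"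
        by (simp add: mult_ac)
      then show ?thesis
        using True by (simp add: g_def h_def ennreal_mult[symmetric])
    qed
    then show "(\<integral>\<^sup>+t. (ennreal (Gamma T * 4 powr T / 2) * g (r * (1 - t)) (r * t)) * indicator {0<..<1} t \<partial>lborel) *
      (ennreal r * indicator {0<..} r) = (\<integral>\<^sup>+t. ennreal (Gamma T * 4 powr T / 2) * h r t \<partial>lborel)"
      by (subst nn_integral_multc[symmetric]) (auto simp: mult.assoc)
  qed
  also have "\<dots> = ennreal (Gamma T * 4 powr T / 2) * (\<integral>\<^sup>+r. \<integral>\<^sup>+t. h r t \<partial>lborel \<partial>lborel)"
    by (simp add: nn_integral_cmult)
  also have "(\<integral>\<^sup>+r. \<integral>\<^sup>+t. h r t \<partial>lborel \<partial>lborel) = (\<integral>\<^sup>+t. \<integral>\<^sup>+r. h r t \<partial>lborel \<partial>lborel)"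
    by (rule lborel_pair.Fubini'[symmetric]) measurable
  also have "\<dots> = (\<integral>\<^sup>+t. ennreal (Gamma R) * (ennreal ((1 - t) powr (m + s / 2) * t powr (n + s / 2) *
         (a\<^sup>2 * (1 - t) + b\<^sup>2 * t) powr (- R)) * indicator {0<..<1} t) \<partial>lborel)"
  proof (rule nn_integral_cong)
    fix t :: real
    show "(\<integral>\<^sup>+r. h r t \<partial>lborel) = ennreal (Gamma R) * (ennreal ((1 - t) powr (m + s / 2) * t powr (n + s / 2) *
         (a\<^sup>2 * (1 - t) + b\<^sup>2 * t) powr (- R)) * indicator {0<..<1} t)"
    proof (cases "0 < t \<and> t < 1")
      case False
      then show ?thesis by (auto simp: h_def)
    next
      case True
      then show ?thesis
        unfolding h_def using nn_integral_powr_exp_scaled[OF \<open>R > 0\<close> A_pos[of t]]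
        by (subst nn_integral_multc) (auto simp: ennreal_mult[symmetric] Gamma_real_pos less_imp_le mult_ac)
    qed
  qed
  also have "\<dots> = ennreal (Gamma R) * (\<integral>\<^sup>+t. ennreal ((1 - t) powr (m + s / 2) * t powr (n + s / 2) *
         (a\<^sup>2 * (1 - t) + b\<^sup>2 * t) powr (- R)) * indicator {0<..<1} t \<partial>lborel)"
    by (rule nn_integral_cmult) measurable
  also have "ennreal c * (ennreal (Gamma T * 4 powr T / 2) * (ennreal (Gamma R) * I)) =
     ennreal (2 powr (m + n + s - 1) * a powr m * b powr n * Gamma T * Gamma R) * I" for I
  proof -
    have "4 powr T = (2 powr (2 * T) :: real)"
      by (simp add: powr_powr[symmetric])
    then have "2 powr (m + n - 2) * 4 powr T = (2 powr (m + n + s) :: real)"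
      by (simp add: powr_add[symmetric] T_def add.assoc)
    then have "2 powr (m + n - 2) * 4 powr T / 2 = (2 powr (m + n + s - 1) :: real)"
      by (simp add: powr_diff)
    then have "c * (Gamma T * 4 powr T / 2) * Gamma R = 2 powr (m + n + s - 1) * a powr m * b powr n * Gamma T * Gamma R"
      by (simp add: c_def mult_ac flip: \<open>_ = 2 powr (m + n + s - 1)\<close>)
    then have "ennreal (2 powr (m + n + s - 1) * a powr m * b powr n * Gamma T * Gamma R) =
        ennreal c * ennreal (Gamma T * 4 powr T / 2) * ennreal (Gamma R)"
      using c0 by (auto simp: ennreal_mult[symmetric] Gamma_real_pos less_imp_le simp del: times_divide_eq_right)
    then show ?thesis by (simp only: mult.assoc)
  qed
  finally show ?thesis by (simp add: T_def R_def)
qed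

subsection \<open>Euler's integral\<close>

lemma nn_integral_Beta:
  assumes "b > 0" "d > (0 :: real)"
  shows "(\<integral>\<^sup>+t. ennreal (t powr (b - 1) * (1 - t) powr (d - 1)) * indicator {0<..<1} t \<partial>lborel) = ennreal (Beta b d)"
  by (rule nn_integral_has_integral_lebesgue')
     (use has_integral_Beta_real[OF assms] in \<open>auto simp: has_integral_Icc_iff_Ioo\<close>)

section \<open>Analytic continuation in the plane cut along [1, infinity)\<close>

definition cut_plane :: "complex set" where
  "cut_plane = - (complex_of_real ` {1..})"

lemma open_cut_plane: "open cut_plane"
proof -
  have "complex_of_real ` {1..} = \<real> \<inter> {z. Re z \<ge> 1}"
    by (auto simp: Reals_def)
  moreover have "closed (\<real> \<inter> {z. Re z \<ge> 1})"
    by (intro closed_Int closed_complex_Reals closed_halfspace_Re_ge)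
  ultimately have "closed (complex_of_real ` {1..})" by simp
  then show ?thesis unfolding cut_plane_def by (rule open_Compl)
qed

text \<open>The cut plane is star-shaped about 0. This yields connectedness, and it keeps 1 - z t
  off the branch cut of the principal power for all t in [0, 1].\<close>

lemma mult_of_real_in_cut_plane:
  assumes "z \<in> cut_plane" "0 \<le> t" "t \<le> 1"
  shows "z * of_real t \<in> cut_plane"
proof -
  have False if "z * of_real t = of_real r" "r \<ge> 1" for r
  proof -
    have "t > 0" using that assms by (cases "t = 0") auto
    then have "z = of_real (r / t)" using that by (simp add: field_simps)
    moreover have "r / t \<ge> 1" using that \<open>t > 0\<close> assms by (simp add: field_simps)
    ultimately have "z \<in> complex_of_real ` {1..}" by (intro image_eqI[where x = "r / t"]) auto
    then show False using assms by (simp add: cut_plane_def)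
  qed
  then show ?thesis by (auto simp: cut_plane_def)
qed

lemma connected_cut_plane: "connected cut_plane"
proof (rule starlike_imp_connected)
  have "closed_segment 0 z \<subseteq> cut_plane" if "z \<in> cut_plane" for z
    using mult_of_real_in_cut_plane[OF that]
    by (auto simp: in_segment scaleR_conv_of_real mult.commute)
  moreover have "0 \<in> cut_plane" by (auto simp: cut_plane_def)
  ultimately show "starlike cut_plane" by (auto simp: starlike_def)
qed

lemma ball_subset_cut_plane: "ball 0 1 \<subseteq> cut_plane"
  by (auto simp: cut_plane_def norm_of_real)

lemma one_minus_in_cut_plane: "z \<in> cut_plane \<Longrightarrow> 1 - z \<notin> \<real>\<^sub>\<le>\<^sub>0"
proof
  assume z: "z \<in> cut_plane" and "1 - z \<in> \<real>\<^sub>\<le>\<^sub>0"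
  then obtain r where "1 - z = of_real r" "r \<le> 0" by (auto elim: nonpos_Reals_cases)
  then have "z = of_real (1 - r)" by (simp add: algebra_simps)
  then have "z \<in> complex_of_real ` {1..}"
    using \<open>r \<le> 0\<close> by (intro image_eqI[where x = "1 - r"]) auto
  then show False using z by (simp add: cut_plane_def)
qed

text \<open>Evaluates the definite description: two candidates agree on the unit disc, because both
  are sums of the same series, and hence on the connected cut plane by the identity theorem.\<close>

lemma hyp2F1_eqI:
  assumes F: "F holomorphic_on cut_plane"
    and sums: "\<And>u. norm u < 1 \<Longrightarrow>
        (\<lambda>k. pochhammer a k * pochhammer b k / pochhammer c k * (u ^ k / fact k)) sums F u"
    and z: "z \<in> cut_plane"
  shows "hyp2F1 a b c z = F z"
  unfolding hyp2F1_def cut_plane_def[symmetric]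
proof (rule the_equality, goal_cases)
  case 1
  show ?case using F sums by blast
next
  case (2 w)
  then obtain G where G: "G holomorphic_on cut_plane" "w = G z"
    "\<And>u. norm u < 1 \<Longrightarrow>
        (\<lambda>k. pochhammer a k * pochhammer b k / pochhammer c k * (u ^ k / fact k)) sums G u"
    by blast
  have "G z = F z"
  proof (rule analytic_continuation_open[of "ball 0 1" cut_plane G F])
    fix u :: complex assume "u \<in> ball 0 1"
    then show "G u = F u" using sums[of u] G(3)[of u] by (auto intro: sums_unique2)
  qed (use G F z open_cut_plane connected_cut_plane ball_subset_cut_plane in auto)
  with G show ?case by simp
qed

text \<open>Principal powers are not multiplicative in general. Here the logarithms of the two sides
  could differ only by a jump of the argument, and this is excluded by continuity from the centre
  z0. The bound by \<delta> keeps (u - z0) q in the unit disc.\<close>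

lemma powr_one_minus_mult_translate:
  fixes z z0 s :: complex
  assumes ball: "ball z0 \<delta> \<subseteq> cut_plane" and z: "z \<in> ball z0 \<delta>" and t: "0 \<le> t" "t \<le> 1"
    and \<delta>: "\<delta> \<le> norm (1 - z0 * of_real t)"
  shows "(1 - z * of_real t) powr s =
    (1 - z0 * of_real t) powr s * (1 - (z - z0) * (of_real t / (1 - z0 * of_real t))) powr s"
proof -
  have "\<delta> > 0" using z by (simp add: le_less_trans[OF zero_le_dist])
  define q where "q = of_real t / (1 - z0 * of_real t)"
  have nz0: "1 - z0 * of_real t \<noteq> 0" using \<delta> \<open>\<delta> > 0\<close> by auto
  have in_cut: "1 - u * of_real t \<notin> \<real>\<^sub>\<le>\<^sub>0" if "u \<in> ball z0 \<delta>" for u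
    using that ball t by (intro one_minus_in_cut_plane mult_of_real_in_cut_plane) auto
  have small: "norm ((u - z0) * q) < 1" if "u \<in> ball z0 \<delta>" for u
  proof -
    have "norm ((u - z0) * q) = norm (u - z0) * t / norm (1 - z0 * of_real t)"
      using t by (simp add: q_def norm_mult norm_divide)
    also have "\<dots> \<le> norm (u - z0) * 1 / \<delta>"
      using t \<delta> \<open>\<delta> > 0\<close> by (intro frac_le mult_left_mono) auto
    also have "\<dots> < 1" using that \<open>\<delta> > 0\<close> by (simp add: dist_norm norm_minus_commute)
    finally show ?thesis .
  qed
  have in_cut': "1 - (u - z0) * q \<notin> \<real>\<^sub>\<le>\<^sub>0" if "u \<in> ball z0 \<delta>" for u
    using small[OF that] ball_subset_cut_plane by (intro one_minus_in_cut_plane) auto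
  have fac: "1 - u * of_real t = (1 - z0 * of_real t) * (1 - (u - z0) * q)" for u
    using nz0 by (simp add: q_def field_simps)
  \<comment> \<open>By \<open>fac\<close> both logarithms have the same derivative in u, so
    \<open>D\<close> is constant on the ball. At the centre the second logarithm is
    \<open>Ln 1 = 0\<close>.\<close>
  define D where "D u = Ln (1 - u * of_real t) - Ln (1 - (u - z0) * q)" for u
  have "\<exists>c. \<forall>u \<in> ball z0 \<delta>. D u = c"
  proof (rule has_field_derivative_zero_constant)
    fix u assume u: "u \<in> ball z0 \<delta>"
    have "(D has_field_derivative - of_real t / (1 - u * of_real t) - - q / (1 - (u - z0) * q)) (at u)"
      unfolding D_def using in_cut[OF u] in_cut'[OF u]
      by (auto intro!: derivative_eq_intros simp: divide_inverse mult.commute)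
    also have "- of_real t / (1 - u * of_real t) - - q / (1 - (u - z0) * q) = 0"
    proof -
      have "- T / (W * V) - - (T / W) / V = 0" for T W V :: complex by simp
      then show ?thesis unfolding fac[of u] unfolding q_def .
    qed
    finally show "(D has_field_derivative 0) (at u within ball z0 \<delta>)"
      by (rule has_field_derivative_at_within)
  qed auto
  then have "D z = D z0" using z \<open>\<delta> > 0\<close> by auto
  then have "Ln (1 - z * of_real t) = Ln (1 - z0 * of_real t) + Ln (1 - (z - z0) * q)"
    by (simp add: D_def algebra_simps)
  then show ?thesis
    using in_cut[OF z] in_cut'[OF z] nz0 unfolding q_def[symmetric]
    by (auto simp: powr_def ring_distribs exp_add)
qed

section \<open>Euler's integral as a holomorphic function\<close>

definition beta_measure :: "real \<Rightarrow> real \<Rightarrow> real measure" where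
  "beta_measure b d = density lborel (\<lambda>t. ennreal (t powr (b - 1) * (1 - t) powr (d - 1)) * indicator {0<..<1} t)"

lemma sets_beta_measure [simp, measurable_cong]: "sets (beta_measure b d) = sets borel"
  and space_beta_measure [simp]: "space (beta_measure b d) = UNIV"
  by (auto simp: beta_measure_def)

lemma nn_integral_beta_measure:
  assumes [measurable]: "f \<in> borel_measurable borel"
  shows "(\<integral>\<^sup>+t. f t \<partial>beta_measure b d) =
    (\<integral>\<^sup>+t. ennreal (t powr (b - 1) * (1 - t) powr (d - 1)) * indicator {0<..<1} t * f t \<partial>lborel)"
  unfolding beta_measure_def by (rule nn_integral_density) auto

lemma AE_beta_measure: "AE t in beta_measure b d. 0 < t \<and> t < 1"
  unfolding beta_measure_def by (subst AE_density) (auto simp: indicator_def)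

lemma emeasure_beta_measure:
  assumes "b > 0" "d > 0"
  shows "emeasure (beta_measure b d) UNIV = ennreal (Beta b d)"
  unfolding nn_integral_Beta[OF assms, symmetric] beta_measure_def
  by (subst emeasure_density) auto

text \<open>With the singular weight moved into the measure, a bound of the remaining integrand that
  is uniform in t suffices for integrability below.\<close>

lemma finite_measure_beta_measure:
  assumes "b > 0" "d > 0"
  shows "finite_measure (beta_measure b d)"
  by (rule finite_measureI) (simp add: emeasure_beta_measure[OF assms])

text \<open>The unnormalised integral: \<open>d\<close> stands for c - b, and division by
  \<open>Beta b d\<close> gives the hypergeometric function with lower parameter c = b + d.\<close>

definition euler_integral :: "real \<Rightarrow> real \<Rightarrow> real \<Rightarrow> complex \<Rightarrow> complex" where
  "euler_integral a b d z = (LINT t|beta_measure b d. (1 - z * of_real t) powr (- of_real a))"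

text \<open>The binomial series of (1 - (z - z0) q)^(-a), integrated term by term. The centre is
  kept general for two uses: z0 = 0 produces the hypergeometric series, arbitrary z0 produces
  holomorphy.\<close>

lemma euler_integral_sums:
  fixes a b d :: real and z z0 :: complex
  assumes abd: "a > 0" "b > 0" "d > 0"
    and ball: "ball z0 \<delta> \<subseteq> cut_plane" and z: "z \<in> ball z0 \<delta>"
    and \<delta>: "\<And>t. 0 \<le> t \<Longrightarrow> t \<le> 1 \<Longrightarrow> \<delta> \<le> norm (1 - z0 * of_real t)"
  shows "(\<lambda>k. (of_real (pochhammer a k / fact k) * (LINT t|beta_measure b d.
            (of_real t / (1 - z0 * of_real t)) ^ k * (1 - z0 * of_real t) powr (- of_real a)))
          * (z - z0) ^ k) sums euler_integral a b d z"
proof -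
  let ?M = "beta_measure b d"
  interpret finite_measure ?M using abd by (intro finite_measure_beta_measure)
  have "\<delta> > 0" using z by (simp add: le_less_trans[OF zero_le_dist])
  define q :: "real \<Rightarrow> complex" where "q t = of_real t / (1 - z0 * of_real t)" for t
  define p where "p t = (1 - z0 * of_real t) powr (- of_real a)" for t
  \<comment> \<open>The ratio of a dominating series independent of t: \<delta> bounds the
    denominator of \<open>q t\<close> from below, and z lies strictly inside the ball, so \<rho> <
    1.\<close>
  define \<rho> where "\<rho> = norm (z - z0) / \<delta>"
  have \<rho>: "0 \<le> \<rho>" "\<rho> < 1" using z \<open>\<delta> > 0\<close> by (auto simp: \<rho>_def dist_norm norm_minus_commute)
  define A where "A k = pochhammer a k / fact k" for k
  have A0: "A k \<ge> 0" for k using abd by (auto simp: A_def intro!: divide_nonneg_pos pochhammer_nonneg)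
  define g where "g k t = of_real (A k) * (q t ^ k * p t) * (z - z0) ^ k" for k t
  have [measurable]: "q \<in> borel_measurable borel" "p \<in> borel_measurable borel"
    unfolding q_def p_def powr_def by measurable
  have [measurable]: "g k \<in> borel_measurable borel" for k
    unfolding g_def by measurable
  have nq: "norm ((z - z0) * q t) \<le> \<rho>" if "0 < t" "t < 1" for t
  proof -
    have "norm ((z - z0) * q t) = norm (z - z0) * t / norm (1 - z0 * of_real t)"
      using that by (simp add: q_def norm_mult norm_divide)
    also have "\<dots> \<le> norm (z - z0) * 1 / \<delta>"
      using that \<delta>[of t] \<open>\<delta> > 0\<close> by (intro frac_le mult_left_mono) auto
    finally show ?thesis by (simp add: \<rho>_def)
  qed
  have np: "norm (p t) \<le> \<delta> powr (- a)" if "0 < t" "t < 1" for t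
  proof -
    have "norm (p t) = norm (1 - z0 * of_real t) powr (- a)"
      unfolding p_def by (subst norm_powr_real_powr') auto
    also have "\<dots> \<le> \<delta> powr (- a)"
      using that \<delta>[of t] \<open>\<delta> > 0\<close> abd by (intro powr_mono2') auto
    finally show ?thesis .
  qed
  have ng: "norm (g k t) \<le> A k * \<rho> ^ k * \<delta> powr (- a)" if "0 < t" "t < 1" for k t
  proof -
    have "norm (g k t) = A k * norm ((z - z0) * q t) ^ k * norm (p t)"
      using A0[of k] by (simp add: g_def norm_mult norm_power power_mult_distrib mult_ac)
    also have "\<dots> \<le> A k * \<rho> ^ k * \<delta> powr (- a)"
      using A0[of k] \<rho> nq[OF that] np[OF that]
      by (intro mult_mono power_mono mult_left_mono mult_nonneg_nonneg) auto
    finally show ?thesis .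
  qed
  \<comment> \<open>\<open>A k\<close> is (-1)^k times the generalised binomial coefficient of -a,
    so this is the binomial series of (1 - \<rho>)^(-a).\<close>
  have A_sums: "summable (\<lambda>k. A k * \<rho> ^ k)"
  proof -
    have "(\<lambda>n. ((- a) gchoose n) * (- \<rho>) ^ n) sums (1 + - \<rho>) powr (- a)"
      using \<rho> by (intro gen_binomial_real) auto
    also have "(\<lambda>n. ((- a) gchoose n) * (- \<rho>) ^ n) = (\<lambda>k. A k * \<rho> ^ k)"
      by (auto simp: gbinomial_pochhammer A_def power_mult_distrib[symmetric] fun_eq_iff)
    finally show ?thesis by (rule sums_summable)
  qed
  have int_g: "integrable ?M (g k)" for k
    by (rule integrable_const_bound[where B = "A k * \<rho> ^ k * \<delta> powr (- a)"])
       (auto intro!: eventually_mono[OF AE_beta_measure] ng)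
  have "(\<lambda>k. integral\<^sup>L ?M (g k)) sums (LINT t|?M. (\<Sum>k. g k t))"
  proof (rule sums_integral[OF int_g])
    show "AE t in ?M. summable (\<lambda>k. norm (g k t))"
      using AE_beta_measure
    proof eventually_elim
      case (elim t)
      show ?case
        by (rule summable_comparison_test'[OF summable_mult2[OF A_sums, of "\<delta> powr (- a)"], of 0])
           (use ng elim in auto)
    qed
    show "summable (\<lambda>k. LINT t|?M. norm (g k t))"
    proof (rule summable_comparison_test'[where N = 0])
      show "summable (\<lambda>k. A k * \<rho> ^ k * \<delta> powr (- a) * measure ?M UNIV)"
        by (intro summable_mult2 A_sums)
      fix k
      have "(LINT t|?M. norm (g k t)) \<le> (LINT t|?M. A k * \<rho> ^ k * \<delta> powr (- a))"
        using int_g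
        by (intro integral_mono_AE) (auto intro!: eventually_mono[OF AE_beta_measure] ng)
      also have "\<dots> = A k * \<rho> ^ k * \<delta> powr (- a) * measure ?M UNIV" by simp
      finally show "norm (LINT t|?M. norm (g k t)) \<le> \<dots>" by simp
    qed
  qed
  also have "(LINT t|?M. (\<Sum>k. g k t)) = euler_integral a b d z"
    unfolding euler_integral_def
  proof (rule integral_cong_AE)
    show "AE t in ?M. (\<Sum>k. g k t) = (1 - z * of_real t) powr (- of_real a)"
      using AE_beta_measure
    proof eventually_elim
      case (elim t)
      have "norm (- ((z - z0) * q t)) < 1" using nq[of t] elim \<rho> by simp
      then have "(\<lambda>k. ((- of_real a) gchoose k) * (- ((z - z0) * q t)) ^ k) sums
         (1 + - ((z - z0) * q t)) powr (- of_real a)"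
        by (rule gen_binomial_complex)
      then have "(\<lambda>k. p t * (((- of_real a) gchoose k) * (- ((z - z0) * q t)) ^ k)) sums
         (p t * (1 + - ((z - z0) * q t)) powr (- of_real a))"
        by (rule sums_mult)
      also have "p t * (1 + - ((z - z0) * q t)) powr (- of_real a) = (1 - z * of_real t) powr (- of_real a)"
        using powr_one_minus_mult_translate[OF ball z _ _ \<delta>, of t "- of_real a"] elim
        by (simp add: p_def q_def)
      also have "(\<lambda>k. p t * (((- of_real a) gchoose k) * (- ((z - z0) * q t)) ^ k)) = (\<lambda>k. g k t)"
      proof
        fix k
        have "complex_of_real (A k) = pochhammer (of_real a) k / fact k"
          by (simp add: A_def pochhammer_of_real)
        then show "p t * (((- of_real a) gchoose k) * (- ((z - z0) * q t)) ^ k) = g k t"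
          unfolding g_def gbinomial_pochhammer power_minus[of "(z - z0) * q t"]
          by (simp add: power_mult_distrib mult_ac flip: power_add)
      qed
      finally show ?case by (simp add: sums_iff)
    qed
  qed (auto simp: powr_def)
  also have "(\<lambda>k. integral\<^sup>L ?M (g k)) = (\<lambda>k. (of_real (pochhammer a k / fact k) *
     (LINT t|?M. (of_real t / (1 - z0 * of_real t)) ^ k * (1 - z0 * of_real t) powr (- of_real a))) * (z - z0) ^ k)"
    unfolding g_def A_def q_def p_def by simp
  finally show ?thesis .
qed

lemma euler_integral_holomorphic:
  assumes abd: "a > 0" "b > 0" "d > 0"
  shows "euler_integral a b d holomorphic_on cut_plane"
proof -
  have "\<exists>f'. (euler_integral a b d has_field_derivative f') (at z0)" if z0: "z0 \<in> cut_plane" for z0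
  proof -
    \<comment> \<open>By compactness the distance from 0 to the segment of all 1 - z0 t is attained.
      It is positive because the segment avoids the branch cut, and so it can serve, together with
      e, as a radius of expansion.\<close>
    have "\<exists>x\<in>{0..1}. \<forall>t\<in>{0..1}. norm (1 - z0 * of_real x) \<le> norm (1 - z0 * of_real t)"
      by (intro continuous_attains_inf continuous_intros) auto
    then obtain x where x: "0 \<le> x" "x \<le> 1"
      and xle: "\<And>t. 0 \<le> t \<Longrightarrow> t \<le> 1 \<Longrightarrow> norm (1 - z0 * of_real x) \<le> norm (1 - z0 * of_real t)"
      by auto
    have "1 - z0 * of_real x \<notin> \<real>\<^sub>\<le>\<^sub>0"
      using z0 x by (intro one_minus_in_cut_plane mult_of_real_in_cut_plane)
    then have pos: "norm (1 - z0 * of_real x) > 0" by auto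
    obtain e where e: "e > 0" "ball z0 e \<subseteq> cut_plane"
      using open_cut_plane z0 by (meson open_contains_ball)
    define \<delta> where "\<delta> = min e (norm (1 - z0 * of_real x))"
    have "\<delta> > 0" using e pos by (simp add: \<delta>_def)
    have "euler_integral a b d holomorphic_on ball z0 \<delta>"
    proof (rule power_series_holomorphic, rule euler_integral_sums[OF abd])
      show "ball z0 \<delta> \<subseteq> cut_plane" using e by (auto simp: \<delta>_def)
      show "\<delta> \<le> norm (1 - z0 * of_real t)" if "0 \<le> t" "t \<le> 1" for t
        using xle[OF that] by (simp add: \<delta>_def)
    qed
    then show ?thesis
      using \<open>\<delta> > 0\<close> by (auto simp: holomorphic_on_open)
  qed
  then show ?thesis by (simp add: holomorphic_on_open open_cut_plane)
qed

text \<open>At centre 0 the coefficient integrals are the moments of t^k, namely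
  \<open>Beta (b + k) d\<close>. Divided by \<open>Beta b d\<close> they give the quotient of the
  Pochhammer symbols of b and b + d.\<close>

lemma hyp2F1_eq_euler_integral:
  assumes abd: "a > 0" "b > 0" "d > (0 :: real)" and z: "z \<in> cut_plane"
  shows "hyp2F1 (of_real a) (of_real b) (of_real (b + d)) z = euler_integral a b d z / of_real (Beta b d)"
proof (rule hyp2F1_eqI[OF _ _ z])
  have B: "Beta b d > 0" using abd by (simp add: Beta_def Gamma_real_pos)
  show "(\<lambda>z. euler_integral a b d z / of_real (Beta b d)) holomorphic_on cut_plane"
    using B by (intro holomorphic_intros euler_integral_holomorphic abd) auto
  fix u :: complex assume u: "norm u < 1"
  let ?M = "beta_measure b d"
  have "(\<lambda>k. (of_real (pochhammer a k / fact k) * (LINT t|?M.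
            (of_real t / (1 - 0 * of_real t)) ^ k * (1 - 0 * of_real t) powr (- of_real a)))
          * (u - 0) ^ k) sums euler_integral a b d u"
    by (rule euler_integral_sums[OF abd ball_subset_cut_plane]) (use u in auto)
  then have "(\<lambda>k. (of_real (pochhammer a k / fact k) * (LINT t|?M.
            (of_real t / (1 - 0 * of_real t)) ^ k * (1 - 0 * of_real t) powr (- of_real a)))
          * (u - 0) ^ k / of_real (Beta b d)) sums (euler_integral a b d u / of_real (Beta b d))"
    by (rule sums_divide)
  also have "(\<lambda>k. (of_real (pochhammer a k / fact k) * (LINT t|?M.
            (of_real t / (1 - 0 * of_real t)) ^ k * (1 - 0 * of_real t) powr (- of_real a)))
          * (u - 0) ^ k / of_real (Beta b d)) =
      (\<lambda>k. pochhammer (of_real a) k * pochhammer (of_real b) k / pochhammer (of_real (b + d)) k * (u ^ k / fact k))"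
  proof
    fix k
    have "(LINT t|?M. (of_real t / (1 - 0 * of_real t)) ^ k * (1 - 0 * of_real t) powr (- of_real a :: complex))
       = of_real (LINT t|?M. t ^ k)"
      by (simp flip: of_real_power)
    also have "(LINT t|?M. t ^ k) = Beta (b + real k) d"
    proof -
      have "(LINT t|?M. t ^ k) = enn2real (\<integral>\<^sup>+t. ennreal (t ^ k) \<partial>?M)"
        by (rule integral_eq_nn_integral) (auto intro: eventually_mono[OF AE_beta_measure])
      also have "(\<integral>\<^sup>+t. ennreal (t ^ k) \<partial>?M) =
         (\<integral>\<^sup>+t. ennreal (t powr (b + real k - 1) * (1 - t) powr (d - 1)) * indicator {0<..<1} t \<partial>lborel)"
        by (subst nn_integral_beta_measure)
           (auto intro!: nn_integral_cong simp: indicator_def ennreal_mult[symmetric] powr_add powr_diff powr_realpow)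
      also have "\<dots> = ennreal (Beta (b + real k) d)"
        by (rule nn_integral_Beta) (use abd in auto)
      finally show ?thesis using abd by (simp add: Beta_def Gamma_real_pos less_imp_le)
    qed
    also have "Beta (b + real k) d = Beta b d * (pochhammer b k / pochhammer (b + d) k)"
    proof -
      have "b \<notin> \<int>\<^sub>\<le>\<^sub>0" "b + d \<notin> \<int>\<^sub>\<le>\<^sub>0" using abd by (auto elim!: nonpos_Ints_cases)
      moreover have "Gamma b \<noteq> 0" "Gamma (b + d) \<noteq> 0"
        using abd by (intro less_imp_neq[THEN not_sym] Gamma_real_pos; simp)+
      ultimately show ?thesis
        using abd by (simp add: pochhammer_Gamma Beta_def field_simps)
    qed
    finally show "(of_real (pochhammer a k / fact k) * (LINT t|?M.
            (of_real t / (1 - 0 * of_real t)) ^ k * (1 - 0 * of_real t) powr (- of_real a)))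
          * (u - 0) ^ k / of_real (Beta b d) =
       pochhammer (of_real a) k * pochhammer (of_real b) k / pochhammer (of_real (b + d)) k * (u ^ k / fact k)"
      using B by (simp add: pochhammer_of_real mult_ac del: of_real_add)
  qed
  finally show "(\<lambda>k. pochhammer (of_real a) k * pochhammer (of_real b) k / pochhammer (of_real (b + d)) k * (u ^ k / fact k))
    sums (euler_integral a b d u / of_real (Beta b d))" .
qed

text \<open>The real witness v links two types: it is the value of the complex function on the real
  axis and, up to the Beta factor, that of an \<open>ennreal\<close> integral, which is thereby
  finite.\<close>

lemma hyp2F1_real_Euler:
  fixes a b d x :: real
  assumes abd: "a > 0" "b > 0" "d > 0" and x: "x < 1"
  obtains v where "v \<ge> 0"
    "hyp2F1 (of_real a) (of_real b) (of_real (b + d)) (of_real x) = of_real v"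
    "(\<integral>\<^sup>+t. ennreal (t powr (b - 1) * (1 - t) powr (d - 1) * (1 - x * t) powr (- a)) * indicator {0<..<1} t \<partial>lborel) =
      ennreal (Beta b d * v)"
proof
  let ?M = "beta_measure b d"
  interpret finite_measure ?M using abd by (intro finite_measure_beta_measure)
  define J where "J = (LINT t|?M. (1 - x * t) powr (- a))"
  have B: "Beta b d > 0" using abd by (simp add: Beta_def Gamma_real_pos)
  \<comment> \<open>1 - x t is affine in t, between its end values 1 and 1 - x, both positive. This
    bounds the negative power uniformly.\<close>
  have lower: "min 1 (1 - x) \<le> 1 - x * t" if "0 < t" "t < 1" for t
  proof (cases "x \<le> 0")
    case True
    then show ?thesis using that by (simp add: mult_nonpos_nonneg)
  next
    case False
    then have "x * t \<le> x * 1" using that by (intro mult_left_mono) auto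
    then show ?thesis by simp
  qed
  have int: "integrable ?M (\<lambda>t. (1 - x * t) powr (- a))"
  proof (rule integrable_const_bound[where B = "min 1 (1 - x) powr (- a)"])
    show "AE t in ?M. norm ((1 - x * t) powr (- a)) \<le> min 1 (1 - x) powr (- a)"
      using AE_beta_measure
    proof eventually_elim
      case (elim t)
      then show ?case using lower[of t] abd x by (auto intro!: powr_mono2')
    qed
  qed auto
  show "J / Beta b d \<ge> 0" using B unfolding J_def
    by (intro divide_nonneg_pos integral_nonneg) auto
  have "of_real x \<in> cut_plane" using x by (auto simp: cut_plane_def)
  then have "hyp2F1 (of_real a) (of_real b) (of_real (b + d)) (of_real x) =
     euler_integral a b d (of_real x) / of_real (Beta b d)"
    by (rule hyp2F1_eq_euler_integral[OF abd])
  also have "euler_integral a b d (of_real x) = (LINT t|?M. of_real ((1 - x * t) powr (- a)))"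
    unfolding euler_integral_def
  proof (rule integral_cong_AE)
    show "AE t in ?M. (1 - of_real x * of_real t) powr - complex_of_real a = of_real ((1 - x * t) powr (- a))"
      using AE_beta_measure
    proof eventually_elim
      case (elim t)
      then have "1 - x * t \<ge> 0" using lower[of t] x by auto
      then show ?case by (subst powr_of_real[symmetric]) auto
    qed
  qed (auto simp: powr_def)
  also have "\<dots> = of_real J" unfolding J_def by simp
  finally show "hyp2F1 (of_real a) (of_real b) (of_real (b + d)) (of_real x) = of_real (J / Beta b d)"
    by simp
  have "(\<integral>\<^sup>+t. ennreal (t powr (b - 1) * (1 - t) powr (d - 1) * (1 - x * t) powr (- a)) * indicator {0<..<1} t \<partial>lborel) =
    (\<integral>\<^sup>+t. ennreal ((1 - x * t) powr (- a)) \<partial>?M)"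
    by (subst nn_integral_beta_measure)
       (auto intro!: nn_integral_cong simp: indicator_def ennreal_mult[symmetric])
  also have "\<dots> = ennreal J"
    unfolding J_def by (rule nn_integral_eq_integral[OF int]) auto
  finally show "(\<integral>\<^sup>+t. ennreal (t powr (b - 1) * (1 - t) powr (d - 1) * (1 - x * t) powr (- a)) * indicator {0<..<1} t \<partial>lborel) =
      ennreal (Beta b d * (J / Beta b d))" using B by simp
qed

subsection \<open>Moments and termwise integration\<close>

lemma has_sum_exp: "((\<lambda>i. u ^ i / fact i) has_sum exp (u :: real)) UNIV"
proof (rule norm_summable_imp_has_sum)
  show "(\<lambda>i. u ^ i / fact i) sums exp u"
    using exp_converges[of u] by (simp add: field_simps)
  show "summable (\<lambda>n. norm (u ^ n / fact n))"
    using summable_norm_exp[of u] by (simp add: field_simps)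
qed

lemma has_sum_exp_mult_exp:
  "((\<lambda>(i, j). u ^ i / fact i * (v ^ j / fact j)) has_sum (exp u * exp (v :: real))) UNIV"
proof -
  let ?f = "\<lambda>(u, v) (i, j). u ^ i / fact i * (v ^ j / fact j) :: real"
  have inner: "((\<lambda>j. ?f (u, v) (i, j)) has_sum (u ^ i / fact i * exp v)) UNIV" for i u v
    unfolding prod.case by (intro has_sum_cmult_right has_sum_exp)
  have outer: "((\<lambda>i. u ^ i / fact i * exp v) has_sum (exp u * exp v)) UNIV" for u v :: real
    by (intro has_sum_cmult_left has_sum_exp)
  \<comment> \<open>With nonnegative terms iterated summability gives joint summability; this is the
    absolute convergence required for arbitrary signs.\<close>
  have "?f (\<bar>u\<bar>, \<bar>v\<bar>) summable_on (SIGMA i:UNIV. UNIV)"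
    using outer[of "\<bar>u\<bar>" "\<bar>v\<bar>"] inner
    by (intro summable_on_SigmaI[where g = "\<lambda>i. \<bar>u\<bar> ^ i / fact i * exp \<bar>v\<bar>"])
       (auto simp: summable_on_def)
  then have "(\<lambda>w. norm (?f (u, v) w)) summable_on (SIGMA i:UNIV. UNIV)"
    by (rule summable_on_cong[THEN iffD1, rotated]) (auto simp: abs_mult power_abs)
  then have "?f (u, v) summable_on (SIGMA i:UNIV. UNIV)"
    by (rule abs_summable_summable)
  then have "(?f (u, v) has_sum (exp u * exp v)) (SIGMA i:UNIV. UNIV)"
    using inner outer by (intro has_sum_SigmaI) auto
  then show ?thesis by simp
qed

text \<open>Enumerating the pairs by \<open>prod_decode\<close> reduces the claim to termwise
  integration of a series. The integrated absolute partial sums stay below the integral of g, and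
  the resulting absolute convergence turns the series back into an unordered sum.\<close>

lemma has_sum_integral_dominated:
  fixes f :: "nat \<times> nat \<Rightarrow> 'a \<Rightarrow> real"
  assumes [measurable]: "\<And>i. f i \<in> borel_measurable M"
    and g: "integrable M g"
    and bound: "\<And>x. x \<in> space M \<Longrightarrow> ((\<lambda>i. \<bar>f i x\<bar>) has_sum g x) UNIV"
    and h: "\<And>x. x \<in> space M \<Longrightarrow> ((\<lambda>i. f i x) has_sum h x) UNIV"
  shows "((\<lambda>i. integral\<^sup>L M (f i)) has_sum integral\<^sup>L M h) UNIV"
proof -
  define e where "e = prod_decode"
  have bij: "bij_betw e UNIV UNIV" by (simp add: e_def bij_prod_decode)
  have int: "integrable M (f i)" for i
  proof (rule Bochner_Integration.integrable_bound[OF g])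
    show "AE x in M. norm (f i x) \<le> norm (g x)"
    proof (intro AE_I2)
      fix x assume "x \<in> space M"
      from finite_sum_le_has_sum[OF bound[OF this], of "{i}"] show "norm (f i x) \<le> norm (g x)" by auto
    qed
  qed auto
  have bound': "(\<lambda>k. \<bar>f (e k) x\<bar>) sums g x" if "x \<in> space M" for x
    using bound[OF that] has_sum_reindex_bij_betw[OF bij, of "\<lambda>i. \<bar>f i x\<bar>"] by (auto intro: has_sum_imp_sums)
  have h': "(\<lambda>k. f (e k) x) sums h x" if "x \<in> space M" for x
    using h[OF that] has_sum_reindex_bij_betw[OF bij, of "\<lambda>i. f i x"] by (auto intro: has_sum_imp_sums)
  have summ: "summable (\<lambda>k. LINT x|M. norm (f (e k) x))"
  proof (rule summableI_nonneg_bounded)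
    fix N
    have "(\<Sum>k<N. LINT x|M. norm (f (e k) x)) = (LINT x|M. (\<Sum>k<N. norm (f (e k) x)))"
      using int by (intro Bochner_Integration.integral_sum[symmetric]) auto
    also have "\<dots> \<le> integral\<^sup>L M g"
    proof (rule integral_mono_AE[OF _ g AE_I2])
      show "integrable M (\<lambda>x. \<Sum>k<N. norm (f (e k) x))"
        using int by (intro Bochner_Integration.integrable_sum) auto
      show "(\<Sum>k<N. norm (f (e k) x)) \<le> g x" if "x \<in> space M" for x
        using bound'[OF that] sum_le_suminf[of "\<lambda>k. \<bar>f (e k) x\<bar>" "{..<N}"] by (simp add: sums_iff)
    qed
    finally show "(\<Sum>k<N. LINT x|M. norm (f (e k) x)) \<le> integral\<^sup>L M g" .
  qed auto
  have "(\<lambda>k. integral\<^sup>L M (f (e k))) sums (LINT x|M. (\<Sum>k. f (e k) x))"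
    using int summ bound' by (intro sums_integral) (auto simp: sums_iff)
  also have "(LINT x|M. (\<Sum>k. f (e k) x)) = integral\<^sup>L M h"
    using h' by (intro Bochner_Integration.integral_cong) (auto simp: sums_iff)
  finally have sums: "(\<lambda>k. integral\<^sup>L M (f (e k))) sums integral\<^sup>L M h" .
  have "summable (\<lambda>k. norm (integral\<^sup>L M (f (e k))))"
    by (rule summable_comparison_test'[OF summ, of 0]) (simp add: integral_abs_bound)
  from norm_summable_imp_has_sum[OF this sums] show ?thesis
    using has_sum_reindex_bij_betw[OF bij, of "\<lambda>i. integral\<^sup>L M (f i)"] by simp
qed

text \<open>The remaining t-integral is Euler's with parameters n + 1 + s/2 and m + 1 + s/2, whose
  sum is m + n + 2 + s. The denominator of their Beta function supplies
  \<open>Gamma (m + n + 2 + s)\<close>.\<close>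

lemma besselK_moment_hyp2F1:
  fixes a b m n s :: real
  assumes ab: "a > 0" "b > 0" and mn: "m > -1/2" "n > -1/2" and s: "s \<ge> 0"
  obtains v where "v \<ge> 0"
    "hyp2F1 (of_real (m + n + 1 + s / 2)) (of_real (n + 1 + s / 2)) (of_real (m + n + 2 + s))
       (of_real (1 - b\<^sup>2 / a\<^sup>2)) = of_real v"
    "(\<integral>\<^sup>+x. ennreal (x powr (m + n + 1 + s) * besselK m (a * x) * besselK n (b * x)) * indicator {0<..} x \<partial>lborel)
     = ennreal (2 powr (m + n + s - 1) * a powr (- m - 2 * n - 2 - s) * b powr n *
         (Gamma (1 + s / 2) * Gamma (m + n + 1 + s / 2) * Gamma (m + 1 + s / 2) * Gamma (n + 1 + s / 2) /
          Gamma (m + n + 2 + s)) * v)"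
proof -
  define R where "R = m + n + 1 + s / 2"
  \<comment> \<open>Chosen so that a^2 (1 - t) + b^2 t = a^2 (1 - \<xi> t). It is below 1 but falls
    below -1 when b^2 > 2 a^2, where only the continuation has a meaning.\<close>
  define \<xi> where "\<xi> = 1 - b\<^sup>2 / a\<^sup>2"
  have pos: "R > 0" "n + 1 + s / 2 > 0" "m + 1 + s / 2 > 0" "1 + s / 2 > 0" "\<xi> < 1"
    using assms by (auto simp: R_def \<xi>_def)
  obtain v where v: "v \<ge> 0"
    "hyp2F1 (of_real R) (of_real (n + 1 + s / 2)) (of_real ((n + 1 + s / 2) + (m + 1 + s / 2))) (of_real \<xi>) = of_real v"
    "(\<integral>\<^sup>+t. ennreal (t powr (n + 1 + s / 2 - 1) * (1 - t) powr (m + 1 + s / 2 - 1) * (1 - \<xi> * t) powr (- R)) * indicator {0<..<1} t \<partial>lborel) =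
      ennreal (Beta (n + 1 + s / 2) (m + 1 + s / 2) * v)"
    by (rule hyp2F1_real_Euler[OF pos(1,2,3,5)])
  have c: "(n + 1 + s / 2) + (m + 1 + s / 2) = m + n + 2 + s" by (simp add: field_simps)
  have "(\<integral>\<^sup>+t. ennreal ((1 - t) powr (m + s / 2) * t powr (n + s / 2) *
         (a\<^sup>2 * (1 - t) + b\<^sup>2 * t) powr (- R)) * indicator {0<..<1} t \<partial>lborel) =
    (\<integral>\<^sup>+t. ennreal (a powr (- 2 * R)) * (ennreal (t powr (n + 1 + s / 2 - 1) * (1 - t) powr (m + 1 + s / 2 - 1) * (1 - \<xi> * t) powr (- R)) * indicator {0<..<1} t) \<partial>lborel)"
  proof (rule nn_integral_cong)
    fix t :: real
    have "a\<^sup>2 * (1 - t) + b\<^sup>2 * t = a powr 2 * (1 - \<xi> * t)"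
      using ab by (simp add: \<xi>_def field_simps)
    moreover have "1 - \<xi> * t \<ge> 0" if "0 < t" "t < 1"
    proof -
      have "a\<^sup>2 * (1 - t) + b\<^sup>2 * t \<ge> 0" using that ab by auto
      with \<open>a\<^sup>2 * (1 - t) + b\<^sup>2 * t = a powr 2 * (1 - \<xi> * t)\<close> ab show ?thesis
        by (simp add: zero_le_mult_iff)
    qed
    ultimately have "(a\<^sup>2 * (1 - t) + b\<^sup>2 * t) powr (- R) = a powr (- 2 * R) * (1 - \<xi> * t) powr (- R)"
      if "0 < t" "t < 1" using that by (simp add: powr_mult powr_powr)
    then show "ennreal ((1 - t) powr (m + s / 2) * t powr (n + s / 2) *
         (a\<^sup>2 * (1 - t) + b\<^sup>2 * t) powr (- R)) * indicator {0<..<1} t =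
      ennreal (a powr (- 2 * R)) * (ennreal (t powr (n + 1 + s / 2 - 1) * (1 - t) powr (m + 1 + s / 2 - 1) * (1 - \<xi> * t) powr (- R)) * indicator {0<..<1} t)"
      by (auto simp: indicator_def ennreal_mult[symmetric] mult_ac)
  qed
  also have "\<dots> = ennreal (a powr (- 2 * R)) * ennreal (Beta (n + 1 + s / 2) (m + 1 + s / 2) * v)"
    unfolding v(3)[symmetric] by (rule nn_integral_cmult) measurable
  finally have I: "(\<integral>\<^sup>+t. ennreal ((1 - t) powr (m + s / 2) * t powr (n + s / 2) *
         (a\<^sup>2 * (1 - t) + b\<^sup>2 * t) powr (- R)) * indicator {0<..<1} t \<partial>lborel) = \<dots>" .
  have a_pow: "a powr m * a powr (- 2 * R) = a powr (- m - 2 * n - 2 - s)"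
    unfolding powr_add[symmetric] by (rule arg_cong[where f = "\<lambda>e. a powr e"]) (simp add: R_def)
  show ?thesis
  proof (rule that)
    show "v \<ge> 0" by fact
    show "hyp2F1 (of_real (m + n + 1 + s / 2)) (of_real (n + 1 + s / 2)) (of_real (m + n + 2 + s))
       (of_real (1 - b\<^sup>2 / a\<^sup>2)) = of_real v"
      using v(2) unfolding c R_def \<xi>_def .
    have "(\<integral>\<^sup>+x. ennreal (x powr (m + n + 1 + s) * besselK m (a * x) * besselK n (b * x)) * indicator {0<..} x \<partial>lborel)
     = ennreal (2 powr (m + n + s - 1) * a powr m * b powr n * Gamma (1 + s / 2) * Gamma R) *
       (ennreal (a powr (- 2 * R)) * ennreal (Beta (n + 1 + s / 2) (m + 1 + s / 2) * v))"
      using nn_integral_besselK_mult_besselK[OF ab, of s m n] pos unfolding R_def[symmetric] I by simp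
    also have "\<dots> = ennreal (2 powr (m + n + s - 1) * a powr m * b powr n * Gamma (1 + s / 2) * Gamma R *
       (a powr (- 2 * R) * (Beta (n + 1 + s / 2) (m + 1 + s / 2) * v)))"
    proof -
      have "ennreal k * (ennreal l * ennreal w) = ennreal (k * (l * w))" if "k \<ge> 0" "l \<ge> 0" "w \<ge> 0" for k l w
        using that by (simp add: ennreal_mult)
      moreover have "Gamma (1 + s / 2) \<ge> 0" "Gamma R \<ge> 0" "Beta (n + 1 + s / 2) (m + 1 + s / 2) \<ge> 0"
        unfolding Beta_def using pos
        by (auto intro!: divide_nonneg_nonneg mult_nonneg_nonneg less_imp_le[OF Gamma_real_pos])
      ultimately show ?thesis using v(1) by simp
    qed
    also have "2 powr (m + n + s - 1) * a powr m * b powr n * Gamma (1 + s / 2) * Gamma R *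
       (a powr (- 2 * R) * (Beta (n + 1 + s / 2) (m + 1 + s / 2) * v)) =
       2 powr (m + n + s - 1) * (a powr m * a powr (- 2 * R)) * b powr n *
         (Gamma (1 + s / 2) * Gamma R * Gamma (m + 1 + s / 2) * Gamma (n + 1 + s / 2) /
          Gamma (m + n + 2 + s)) * v"
      unfolding Beta_def c by (simp add: mult_ac)
    finally show "(\<integral>\<^sup>+x. ennreal (x powr (m + n + 1 + s) * besselK m (a * x) * besselK n (b * x)) * indicator {0<..} x \<partial>lborel)
     = ennreal (2 powr (m + n + s - 1) * a powr (- m - 2 * n - 2 - s) * b powr n *
         (Gamma (1 + s / 2) * Gamma (m + n + 1 + s / 2) * Gamma (m + 1 + s / 2) * Gamma (n + 1 + s / 2) /
          Gamma (m + n + 2 + s)) * v)"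
      unfolding R_def[symmetric] a_pow .
  qed
qed

text \<open>The exponent collects the factor \<open>\<bar>y\<bar>\<close> of the ratio density and
  the powers m and n of the two variance-gamma densities. The absolute values make the weight
  even.\<close>

definition besselK_weight :: "real \<Rightarrow> real \<Rightarrow> real \<Rightarrow> real \<Rightarrow> real \<Rightarrow> real" where
  "besselK_weight m n a b y = \<bar>y\<bar> powr (m + n + 1) * besselK m (a * \<bar>y\<bar>) * besselK n (b * \<bar>y\<bar>)"

lemma measurable_besselK_weight [measurable]: "besselK_weight m n a b \<in> borel_measurable borel"
  unfolding besselK_weight_def by measurable

lemma besselK_weight_nonneg: "besselK_weight m n a b y \<ge> 0"
  by (simp add: besselK_weight_def besselK_nonneg)

lemma besselK_weight_minus [simp]: "besselK_weight m n a b (- y) = besselK_weight m n a b y"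
  by (simp add: besselK_weight_def)

text \<open>Each exponential is absorbed by one Bessel function, whose rate drops to a - c or b - d
  and stays positive. What remains is a moment of order 0, known to be finite.\<close>

lemma integrable_besselK_weight_exp:
  assumes mn: "m > -1/2" "n > -1/2" and c: "0 \<le> c" "c < a" "0 \<le> d" "d < b"
  shows "integrable lborel (\<lambda>y. besselK_weight m n a b y * (exp (c * \<bar>y\<bar>) * exp (d * \<bar>y\<bar>)))"
proof (rule integrableI_nonneg)
  let ?f = "\<lambda>y. besselK_weight m n a b y * (exp (c * \<bar>y\<bar>) * exp (d * \<bar>y\<bar>))"
  have ac: "a - c > 0" "b - d > 0" "a > 0" "b > 0" using c by auto
  have "(\<integral>\<^sup>+y. ennreal (?f y) \<partial>lborel) = (\<integral>\<^sup>+y. (ennreal (?f y) + ennreal (?f (- y))) * indicator {0<..} y \<partial>lborel)"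
    by (rule nn_integral_fold_at_0) measurable
  \<comment> \<open>The summand \<open>0\<close> in the exponent matches the moment formula at s =
    0.\<close>
  also have "\<dots> \<le> (\<integral>\<^sup>+y. 2 * (ennreal (y powr (m + n + 1 + 0) * besselK m ((a - c) * y) * besselK n ((b - d) * y)) * indicator {0<..} y) \<partial>lborel)"
  proof (rule nn_integral_mono)
    fix y :: real
    have "?f y \<le> y powr (m + n + 1) * besselK m ((a - c) * y) * besselK n ((b - d) * y)" if "y > 0"
    proof -
      have 1: "exp (c * y) * besselK m (a * y) \<le> besselK m ((a - c) * y)"
        using exp_mult_besselK_le[of "c / a" "a * y" m] that c ac by (simp add: left_diff_distrib)
      have 2: "exp (d * y) * besselK n (b * y) \<le> besselK n ((b - d) * y)"
        using exp_mult_besselK_le[of "d / b" "b * y" n] that c ac by (simp add: left_diff_distrib)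
      have "?f y = y powr (m + n + 1) * ((exp (c * y) * besselK m (a * y)) * (exp (d * y) * besselK n (b * y)))"
        using that by (simp add: besselK_weight_def)
      also have "\<dots> \<le> y powr (m + n + 1) * (besselK m ((a - c) * y) * besselK n ((b - d) * y))"
        by (intro mult_left_mono mult_mono 1 2) (auto intro: mult_nonneg_nonneg besselK_nonneg)
      finally show ?thesis by (simp add: mult_ac)
    qed
    then show "(ennreal (?f y) + ennreal (?f (- y))) * indicator {0<..} y \<le>
      2 * (ennreal (y powr (m + n + 1 + 0) * besselK m ((a - c) * y) * besselK n ((b - d) * y)) * indicator {0<..} y)"
      by (auto simp: indicator_def mult_2[symmetric] intro!: mult_left_mono ennreal_leI)
  qed
  also have "\<dots> = 2 * (\<integral>\<^sup>+y. (ennreal (y powr (m + n + 1 + 0) * besselK m ((a - c) * y) * besselK n ((b - d) * y)) * indicator {0<..} y) \<partial>lborel)"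
    by (rule nn_integral_cmult) measurable
  also have "\<dots> < \<infinity>"
    by (rule besselK_moment_hyp2F1[OF ac(1,2) mn order_refl]) (simp add: ennreal_mult_less_top)
  finally show "(\<integral>\<^sup>+y. ennreal (?f y) \<partial>lborel) < \<infinity>" .
qed (auto intro!: mult_nonneg_nonneg besselK_weight_nonneg)

text \<open>Reflection y to -y turns the integrand into its negative, so the integral equals its own
  negative.\<close>

lemma integral_besselK_weight_odd_power:
  assumes "odd s"
  shows "(LINT y|lborel. besselK_weight m n a b y * y ^ s) = 0"
  using lborel_integral_real_affine[of "-1" "\<lambda>y. besselK_weight m n a b y * y ^ s" 0] assms
  by simp

text \<open>The integrand is even and nonnegative, so this is twice the moment over the half-line;
  the doubling raises the exponent of 2 from m + n + s - 1 to m + n + s.\<close>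

lemma integral_besselK_weight_even_power:
  fixes a b m n :: real and s :: nat
  assumes ab: "a > 0" "b > 0" and mn: "m > -1/2" "n > -1/2" and s: "even s"
  shows "complex_of_real (LINT y|lborel. besselK_weight m n a b y * y ^ s) =
    complex_of_real (2 powr (m + n + s) * a powr (- m - 2 * n - 2 - s) * b powr n *
         (Gamma (1 + s / 2) * Gamma (m + n + 1 + s / 2) * Gamma (m + 1 + s / 2) * Gamma (n + 1 + s / 2) /
          Gamma (m + n + 2 + s))) *
    hyp2F1 (of_real (m + n + 1 + s / 2)) (of_real (n + 1 + s / 2)) (of_real (m + n + 2 + s))
       (of_real (1 - b\<^sup>2 / a\<^sup>2))"
proof -
  let ?f = "\<lambda>y. besselK_weight m n a b y * y ^ s"
  have f0: "?f y \<ge> 0" for y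
    using s besselK_weight_nonneg by (intro mult_nonneg_nonneg) (auto simp: zero_le_even_power)
  obtain v where v: "v \<ge> 0"
    "hyp2F1 (of_real (m + n + 1 + s / 2)) (of_real (n + 1 + s / 2)) (of_real (m + n + 2 + s))
       (of_real (1 - b\<^sup>2 / a\<^sup>2)) = of_real v"
    "(\<integral>\<^sup>+x. ennreal (x powr (m + n + 1 + s) * besselK m (a * x) * besselK n (b * x)) * indicator {0<..} x \<partial>lborel)
     = ennreal (2 powr (m + n + s - 1) * a powr (- m - 2 * n - 2 - s) * b powr n *
         (Gamma (1 + s / 2) * Gamma (m + n + 1 + s / 2) * Gamma (m + 1 + s / 2) * Gamma (n + 1 + s / 2) /
          Gamma (m + n + 2 + s)) * v)"
    using besselK_moment_hyp2F1[OF ab mn of_nat_0_le_iff[of s]] by blast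
  define C where "C = a powr (- m - 2 * n - 2 - s) * b powr n *
         (Gamma (1 + s / 2) * Gamma (m + n + 1 + s / 2) * Gamma (m + 1 + s / 2) * Gamma (n + 1 + s / 2) /
          Gamma (m + n + 2 + s))"
  have C0: "C \<ge> 0" unfolding C_def using mn
    by (intro mult_nonneg_nonneg divide_nonneg_nonneg less_imp_le[OF Gamma_real_pos]) auto
  have "(\<integral>\<^sup>+y. ennreal (?f y) \<partial>lborel) = (\<integral>\<^sup>+y. (ennreal (?f y) + ennreal (?f (- y))) * indicator {0<..} y \<partial>lborel)"
    by (rule nn_integral_fold_at_0) measurable
  also have "\<dots> = (\<integral>\<^sup>+x. 2 * (ennreal (x powr (m + n + 1 + s) * besselK m (a * x) * besselK n (b * x)) * indicator {0<..} x) \<partial>lborel)"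
    using s by (intro nn_integral_cong)
      (auto simp: indicator_def mult_2[symmetric] besselK_weight_def powr_add powr_realpow mult_ac)
  also have "\<dots> = 2 * (\<integral>\<^sup>+x. (ennreal (x powr (m + n + 1 + s) * besselK m (a * x) * besselK n (b * x)) * indicator {0<..} x) \<partial>lborel)"
    by (rule nn_integral_cmult) measurable
  also have "\<dots> = ennreal 2 * ennreal (2 powr (m + n + s - 1) * C * v)"
    unfolding v(3) C_def by (simp add: mult_ac)
  also have "\<dots> = ennreal (2 powr (m + n + s) * C * v)"
    using C0 v(1) by (subst ennreal_mult[symmetric]) (auto simp: powr_diff)
  finally have "(\<integral>\<^sup>+y. ennreal (?f y) \<partial>lborel) = ennreal (2 powr (m + n + s) * C * v)" .
  moreover have "(LINT y|lborel. ?f y) = enn2real (\<integral>\<^sup>+y. ennreal (?f y) \<partial>lborel)"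
    by (rule integral_eq_nn_integral) (use f0 in auto)
  ultimately have "(LINT y|lborel. ?f y) = 2 powr (m + n + s) * C * v"
    using C0 v(1) by simp
  then show ?thesis unfolding v(2) of_real_mult[symmetric] C_def by (simp only: mult.assoc)
qed

subsection \<open>The ratio of variance-gamma variables\<close>

text \<open>For fixed nonzero y the substitution x = y z in the joint density has Jacobian
  \<open>\<bar>y\<bar>\<close>; Tonelli then moves the z-integral outside.\<close>

lemma (in prob_space) distributed_ratio:
  fixes X Y :: "'a \<Rightarrow> real" and f g :: "real \<Rightarrow> real"
  assumes X: "distributed M lborel X (\<lambda>x. ennreal (f x))" and Y: "distributed M lborel Y (\<lambda>x. ennreal (g x))"
    and indep: "indep_var borel X borel Y"
    and [measurable]: "f \<in> borel_measurable borel" "g \<in> borel_measurable borel"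
    and nonneg: "\<And>x. f x \<ge> 0" "\<And>x. g x \<ge> 0"
  shows "distributed M lborel (\<lambda>\<omega>. X \<omega> / Y \<omega>) (\<lambda>z. ennreal (ratio_density f g z))"
proof -
  have [measurable]: "X \<in> borel_measurable M" "Y \<in> borel_measurable M"
    using distributed_measurable[OF X] distributed_measurable[OF Y] by simp_all
  have "indep_var lborel X lborel Y"
    using indep unfolding indep_var_eq by simp
  then have joint: "distributed M (lborel \<Otimes>\<^sub>M lborel) (\<lambda>\<omega>. (X \<omega>, Y \<omega>)) (\<lambda>(x, y). ennreal (f x) * ennreal (g y))"
    by (intro distributed_joint_indep X Y) (auto intro: sigma_finite_lborel)
  \<comment> \<open>The candidate density with values in \<open>ennreal\<close>, which unlike the
    Lebesgue integral in \<open>ratio_density\<close> may be infinite at some z.\<close>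
  define D where "D z = (\<integral>\<^sup>+y. ennreal (\<bar>y\<bar> * f (y * z) * g y) \<partial>lborel)" for z
  have [measurable]: "D \<in> borel_measurable borel" unfolding D_def by measurable
  have [measurable]: "ratio_density f g \<in> borel_measurable borel"
    unfolding ratio_density_def by measurable
  have distr: "distr M lborel (\<lambda>\<omega>. X \<omega> / Y \<omega>) = density lborel D"
  proof (rule measure_eqI)
    fix A assume "A \<in> sets (distr M lborel (\<lambda>\<omega>. X \<omega> / Y \<omega>))"
    then have [measurable]: "A \<in> sets borel" by simp
    have "emeasure (distr M lborel (\<lambda>\<omega>. X \<omega> / Y \<omega>)) A = (\<integral>\<^sup>+u. indicator A u \<partial>distr M lborel (\<lambda>\<omega>. X \<omega> / Y \<omega>))"
      by simp
    also have "\<dots> = (\<integral>\<^sup>+\<omega>. indicator A (X \<omega> / Y \<omega>) \<partial>M)"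
      by (rule nn_integral_distr) auto
    also have "\<dots> = (\<integral>\<^sup>+\<omega>. (\<lambda>(x, y). indicator A (x / y)) (X \<omega>, Y \<omega>) \<partial>M)" by simp
    also have "\<dots> = (\<integral>\<^sup>+(x, y). ennreal (f x) * ennreal (g y) * indicator A (x / y) \<partial>(lborel \<Otimes>\<^sub>M lborel))"
      by (subst distributed_nn_integral[OF joint, symmetric]) (auto intro!: nn_integral_cong)
    also have "\<dots> = (\<integral>\<^sup>+y. \<integral>\<^sup>+x. ennreal (f x) * ennreal (g y) * indicator A (x / y) \<partial>lborel \<partial>lborel)"
      by (subst lborel_pair.nn_integral_snd[symmetric]) auto
    also have "\<dots> = (\<integral>\<^sup>+y. \<integral>\<^sup>+z. ennreal (\<bar>y\<bar> * f (y * z) * g y) * indicator A z \<partial>lborel \<partial>lborel)"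
    \<comment> \<open>The point y = 0, where the quotient takes the default value 0, is a null set
      for the integral in y.\<close>
    proof (rule nn_integral_cong_AE, rule AE_mp[OF AE_lborel_singleton[of 0]], intro AE_I2 impI)
      fix y :: real assume y: "y \<noteq> 0"
      have "(\<integral>\<^sup>+x. ennreal (f x) * ennreal (g y) * indicator A (x / y) \<partial>lborel) =
         \<bar>y\<bar> * (\<integral>\<^sup>+z. ennreal (f (0 + y * z)) * ennreal (g y) * indicator A ((0 + y * z) / y) \<partial>lborel)"
        using y by (intro nn_integral_real_affine) auto
      also have "\<dots> = (\<integral>\<^sup>+z. \<bar>y\<bar> * (ennreal (f (0 + y * z)) * ennreal (g y) * indicator A ((0 + y * z) / y)) \<partial>lborel)"
        by (rule nn_integral_cmult[symmetric]) measurable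
      also have "\<dots> = (\<integral>\<^sup>+z. ennreal (\<bar>y\<bar> * f (y * z) * g y) * indicator A z \<partial>lborel)"
        using y nonneg by (intro nn_integral_cong) (simp add: ennreal_mult mult_ac)
      finally show "(\<integral>\<^sup>+x. ennreal (f x) * ennreal (g y) * indicator A (x / y) \<partial>lborel) = \<dots>" .
    qed
    also have "\<dots> = (\<integral>\<^sup>+z. \<integral>\<^sup>+y. ennreal (\<bar>y\<bar> * f (y * z) * g y) * indicator A z \<partial>lborel \<partial>lborel)"
      by (rule lborel_pair.Fubini') measurable
    also have "\<dots> = (\<integral>\<^sup>+z. D z * indicator A z \<partial>lborel)"
      unfolding D_def by (intro nn_integral_cong nn_integral_multc) measurable
    also have "\<dots> = emeasure (density lborel D) A"
      by (subst emeasure_density) auto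
    finally show "emeasure (distr M lborel (\<lambda>\<omega>. X \<omega> / Y \<omega>)) A = emeasure (density lborel D) A" .
  qed simp
  \<comment> \<open>\<open>D\<close> has total mass 1 and so is finite almost everywhere. Where it
    is infinite, the Lebesgue integral would be 0 by default and differ from it.\<close>
  have "(\<integral>\<^sup>+z. D z \<partial>lborel) = emeasure (density lborel D) UNIV"
    by (subst emeasure_density) auto
  also have "\<dots> = emeasure M (space M)"
    unfolding distr[symmetric] by (subst emeasure_distr) auto
  finally have "(\<integral>\<^sup>+z. D z \<partial>lborel) \<noteq> \<infinity>" using emeasure_space_1 by simp
  then have "AE z in lborel. D z \<noteq> \<infinity>"
    by (intro nn_integral_PInf_AE) auto
  then have "AE z in lborel. D z = ennreal (ratio_density f g z)"
  proof eventually_elim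
    case (elim z)
    have "ratio_density f g z = enn2real (D z)"
      unfolding ratio_density_def D_def using nonneg
      by (intro integral_eq_nn_integral) auto
    with elim show ?case by (simp add: less_top)
  qed
  then have "density lborel D = density lborel (\<lambda>z. ennreal (ratio_density f g z))"
    by (intro density_cong) auto
  with distr show ?thesis by (auto simp: distributed_def)
qed

section \<open>Series expansion of the variance-gamma ratio density\<close>

lemma measurable_vg_density [measurable]: "vg_density m \<alpha> \<beta> \<in> borel_measurable borel"
  unfolding vg_density_def by measurable

lemma vg_density_nonneg: "m > -1/2 \<Longrightarrow> vg_density m \<alpha> \<beta> x \<ge> 0"
  unfolding vg_density_def
  by (intro mult_nonneg_nonneg divide_nonneg_nonneg less_imp_le[OF Gamma_real_pos] besselK_nonneg) auto

text \<open>\<open>K\<close> gathers everything independent of y: both normalising constants and the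
  factor \<open>\<bar>z\<bar> powr m\<close> split off from the power of
  \<open>\<bar>y * z\<bar>\<close>. The two exponentials are expanded separately, whence the double
  index.\<close>

lemma ratio_density_vg_has_sum:
  fixes m n \<alpha>\<^sub>1 \<alpha>\<^sub>2 \<beta>\<^sub>1 \<beta>\<^sub>2 z :: real
  assumes mn: "m > -1/2" "n > -1/2" and ab: "\<bar>\<beta>\<^sub>1\<bar> < \<alpha>\<^sub>1" "\<bar>\<beta>\<^sub>2\<bar> < \<alpha>\<^sub>2" and z: "z \<noteq> 0"
  defines "K \<equiv> sqrt (\<alpha>\<^sub>1\<^sup>2 - \<beta>\<^sub>1\<^sup>2) powr (2 * m + 1) * sqrt (\<alpha>\<^sub>2\<^sup>2 - \<beta>\<^sub>2\<^sup>2) powr (2 * n + 1) * \<bar>z\<bar> powr m /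
     (pi * (2 * \<alpha>\<^sub>1) powr m * (2 * \<alpha>\<^sub>2) powr n * Gamma (m + 1/2) * Gamma (n + 1/2))"
  shows "((\<lambda>(i, j). K * (\<beta>\<^sub>1 ^ i * z ^ i * \<beta>\<^sub>2 ^ j / (fact i * fact j) *
      (LINT y|lborel. besselK_weight m n (\<alpha>\<^sub>1 * \<bar>z\<bar>) \<alpha>\<^sub>2 y * y ^ (i + j)))) has_sum
    ratio_density (vg_density m \<alpha>\<^sub>1 \<beta>\<^sub>1) (vg_density n \<alpha>\<^sub>2 \<beta>\<^sub>2) z) UNIV"
proof -
  define W where "W = besselK_weight m n (\<alpha>\<^sub>1 * \<bar>z\<bar>) \<alpha>\<^sub>2"
  have [measurable]: "W \<in> borel_measurable borel" by (simp add: W_def)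
  have W0: "W y \<ge> 0" for y by (simp add: W_def besselK_weight_nonneg)
  define f where "f = (\<lambda>(i, j) y. W y * ((\<beta>\<^sub>1 * z * y) ^ i / fact i * ((\<beta>\<^sub>2 * y) ^ j / fact j)))"
  have "((\<lambda>i. integral\<^sup>L lborel (f i)) has_sum (LINT y|lborel. W y * (exp (\<beta>\<^sub>1 * z * y) * exp (\<beta>\<^sub>2 * y)))) UNIV"
  proof (rule has_sum_integral_dominated)
    show "f i \<in> borel_measurable lborel" for i
      unfolding f_def by (cases i) (simp, measurable)
    \<comment> \<open>Since z is nonzero, the bound on \<open>\<beta>\<^sub>1\<close> scales to
      \<bar>\<open>\<beta>\<^sub>1 * z\<close>\<bar> <
      \<open>\<alpha>\<^sub>1 * \<bar>z\<bar>\<close>, so the dominating exponentials grow more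
      slowly than the Bessel functions decay.\<close>
    show "integrable lborel (\<lambda>y. W y * (exp (\<bar>\<beta>\<^sub>1 * z\<bar> * \<bar>y\<bar>) * exp (\<bar>\<beta>\<^sub>2\<bar> * \<bar>y\<bar>)))"
      unfolding W_def using ab z mn
      by (intro integrable_besselK_weight_exp) (auto simp: abs_mult)
    show "((\<lambda>i. \<bar>f i y\<bar>) has_sum W y * (exp (\<bar>\<beta>\<^sub>1 * z\<bar> * \<bar>y\<bar>) * exp (\<bar>\<beta>\<^sub>2\<bar> * \<bar>y\<bar>))) UNIV" for y
    proof -
      have "(\<lambda>i. \<bar>f i y\<bar>) = (\<lambda>i. W y * (\<lambda>(i, j). (\<bar>\<beta>\<^sub>1 * z\<bar> * \<bar>y\<bar>) ^ i / fact i * ((\<bar>\<beta>\<^sub>2\<bar> * \<bar>y\<bar>) ^ j / fact j)) i)"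
        using W0[of y] by (auto simp: f_def fun_eq_iff abs_mult power_abs)
      then show ?thesis using has_sum_cmult_right[OF has_sum_exp_mult_exp] by simp
    qed
    show "((\<lambda>i. f i y) has_sum W y * (exp (\<beta>\<^sub>1 * z * y) * exp (\<beta>\<^sub>2 * y))) UNIV" for y
    proof -
      have "(\<lambda>i. f i y) = (\<lambda>i. W y * (\<lambda>(i, j). (\<beta>\<^sub>1 * z * y) ^ i / fact i * ((\<beta>\<^sub>2 * y) ^ j / fact j)) i)"
        by (auto simp: f_def fun_eq_iff)
      then show ?thesis using has_sum_cmult_right[OF has_sum_exp_mult_exp] by simp
    qed
  qed
  then have "((\<lambda>i. K * integral\<^sup>L lborel (f i)) has_sum K * (LINT y|lborel. W y * (exp (\<beta>\<^sub>1 * z * y) * exp (\<beta>\<^sub>2 * y)))) UNIV"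
    by (rule has_sum_cmult_right)
  also have "K * (LINT y|lborel. W y * (exp (\<beta>\<^sub>1 * z * y) * exp (\<beta>\<^sub>2 * y))) =
     ratio_density (vg_density m \<alpha>\<^sub>1 \<beta>\<^sub>1) (vg_density n \<alpha>\<^sub>2 \<beta>\<^sub>2) z"
    unfolding ratio_density_def integral_mult_right_zero[symmetric]
  proof (rule Bochner_Integration.integral_cong[OF refl])
    fix y :: real
    \<comment> \<open>At y = 0 both sides vanish, because \<open>0 powr e = 0\<close> for every
      exponent, also a negative one.\<close>
    have "\<bar>y\<bar> * \<bar>y\<bar> powr m * \<bar>y\<bar> powr n = \<bar>y\<bar> powr (m + n + 1)"
      by (cases "y = 0") (simp_all add: powr_add)
    then have weights: "\<bar>y\<bar> powr (m + n + 1) * \<bar>z\<bar> powr m = \<bar>y\<bar> * \<bar>y * z\<bar> powr m * \<bar>y\<bar> powr n"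
      by (simp add: abs_mult powr_mult mult_ac)
    have regroup: "g1 * g2 * zm / (pi * c1 * c2 * G1 * G2) * (Y * k1 * k2 * (e1 * e2)) =
        yy * (g1 / (sqrt pi * c1 * G1) * e1 * yz * k1) * (g2 / (sqrt pi * c2 * G2) * e2 * yn * k2)"
      if "Y * zm = yy * yz * yn" for g1 g2 zm c1 c2 G1 G2 Y k1 k2 e1 e2 yy yz yn :: real
    proof -
      have "g1 * g2 * zm / (pi * c1 * c2 * G1 * G2) * (Y * k1 * k2 * (e1 * e2)) =
          g1 * g2 / ((sqrt pi * sqrt pi) * c1 * c2 * G1 * G2) * (Y * zm) * (k1 * k2 * e1 * e2)"
        by (simp add: mult_ac)
      also have "\<dots> = yy * (g1 / (sqrt pi * c1 * G1) * e1 * yz * k1) * (g2 / (sqrt pi * c2 * G2) * e2 * yn * k2)"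
        unfolding that by (simp add: mult_ac del: real_sqrt_mult_self)
      finally show ?thesis .
    qed
    show "K * (W y * (exp (\<beta>\<^sub>1 * z * y) * exp (\<beta>\<^sub>2 * y))) =
      \<bar>y\<bar> * vg_density m \<alpha>\<^sub>1 \<beta>\<^sub>1 (y * z) * vg_density n \<alpha>\<^sub>2 \<beta>\<^sub>2 y"
    proof -
      have "\<alpha>\<^sub>1 * \<bar>z\<bar> * \<bar>y\<bar> = \<alpha>\<^sub>1 * \<bar>y * z\<bar>" "\<beta>\<^sub>1 * z * y = \<beta>\<^sub>1 * (y * z)"
        by (simp_all add: abs_mult mult_ac)
      then show ?thesis
        unfolding K_def W_def besselK_weight_def vg_density_def by (simp only: regroup[OF weights])
    qed
  qed
  also have "(\<lambda>i. K * integral\<^sup>L lborel (f i)) =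
    (\<lambda>(i, j). K * (\<beta>\<^sub>1 ^ i * z ^ i * \<beta>\<^sub>2 ^ j / (fact i * fact j) * (LINT y|lborel. W y * y ^ (i + j))))"
  proof
    fix w :: "nat \<times> nat"
    obtain i j where w: "w = (i, j)" by (cases w)
    have "f (i, j) = (\<lambda>y. \<beta>\<^sub>1 ^ i * z ^ i * \<beta>\<^sub>2 ^ j / (fact i * fact j) * (W y * y ^ (i + j)))"
      by (auto simp: f_def fun_eq_iff power_mult_distrib power_add)
    then show "K * integral\<^sup>L lborel (f w) = (\<lambda>(i, j). K * (\<beta>\<^sub>1 ^ i * z ^ i * \<beta>\<^sub>2 ^ j / (fact i * fact j) * (LINT y|lborel. W y * y ^ (i + j)))) w"
      unfolding w by simp
  qed
  finally show ?thesis unfolding W_def .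
qed

text \<open>Evenness of i + j replaces \<bar>z\<bar>^(i+j) by z^i z^j. The factor z^i then cancels,
  which leaves the signed power z^(-j) of the claimed expansion.\<close>

lemma vg_coefficient_cancel:
  fixes m n \<alpha>\<^sub>1 \<alpha>\<^sub>2 z :: real and i j :: nat
  assumes "\<alpha>\<^sub>1 > 0" "\<alpha>\<^sub>2 > 0" "z \<noteq> 0" "even (i + j)"
  shows "\<bar>z\<bar> powr m / ((2 * \<alpha>\<^sub>1) powr m * (2 * \<alpha>\<^sub>2) powr n) * z ^ i *
      (2 powr (m + n + real (i + j)) * (\<alpha>\<^sub>1 * \<bar>z\<bar>) powr (- m - 2 * n - 2 - real (i + j)) * \<alpha>\<^sub>2 powr n) =
    \<bar>z\<bar> powr (- 2 * n - 2) / \<alpha>\<^sub>1 powr (2 * m + 2 * n + 2) * (2 ^ (i + j) * z powi (- int j) / \<alpha>\<^sub>1 ^ (i + j))"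
proof -
  have two: "2 powr (m + n + real (i + j)) = 2 powr m * 2 powr n * 2 ^ (i + j)"
    by (simp add: powr_add powr_realpow flip: of_nat_add)
  have alpha: "\<alpha>\<^sub>1 powr (- m - 2 * n - 2 - real (i + j)) = \<alpha>\<^sub>1 powr m / \<alpha>\<^sub>1 powr (2 * m + 2 * n + 2) / \<alpha>\<^sub>1 ^ (i + j)"
  proof -
    have "\<alpha>\<^sub>1 powr (- m - 2 * n - 2 - real (i + j)) = \<alpha>\<^sub>1 powr (m - (2 * m + 2 * n + 2) - real (i + j))"
      by (rule arg_cong[where f = "\<lambda>e. \<alpha>\<^sub>1 powr e"]) simp
    also have "\<dots> = \<alpha>\<^sub>1 powr m / \<alpha>\<^sub>1 powr (2 * m + 2 * n + 2) / \<alpha>\<^sub>1 powr real (i + j)"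
      by (simp only: powr_diff)
    finally show ?thesis using assms by (simp only: powr_realpow)
  qed
  have zpow: "\<bar>z\<bar> powr (- m - 2 * n - 2 - real (i + j)) = \<bar>z\<bar> powr (- 2 * n - 2) / \<bar>z\<bar> powr m / (z ^ i * z ^ j)"
  proof -
    have "\<bar>z\<bar> powr (- m - 2 * n - 2 - real (i + j)) = \<bar>z\<bar> powr ((- 2 * n - 2) - m - real (i + j))"
      by (rule arg_cong[where f = "\<lambda>e. \<bar>z\<bar> powr e"]) simp
    also have "\<dots> = \<bar>z\<bar> powr (- 2 * n - 2) / \<bar>z\<bar> powr m / \<bar>z\<bar> powr real (i + j)"
      by (simp only: powr_diff)
    also have "\<bar>z\<bar> powr real (i + j) = z ^ i * z ^ j"
      using assms by (subst powr_realpow) (auto simp: power_even_abs power_add[symmetric])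
    finally show ?thesis .
  qed
  have "\<alpha>\<^sub>1 powr m \<noteq> 0" "\<alpha>\<^sub>2 powr n \<noteq> 0" "2 powr m \<noteq> (0 :: real)" "2 powr n \<noteq> (0 :: real)" "\<bar>z\<bar> powr m \<noteq> 0" "z ^ i \<noteq> 0"
    using assms by auto
  moreover have "z powi (- int j) = 1 / z ^ j"
    by (simp add: power_int_minus field_simps)
  ultimately show ?thesis
    using assms by (simp only: powr_mult two alpha zpow less_imp_le abs_ge_zero zero_le_numeral) (simp add: field_simps)
qed

text \<open>The identity is stated over the complex numbers because \<open>hyp2F1\<close> is
  complex-valued. Summability is asserted separately because \<open>infsum\<close> has the default
  value 0 on families that are not summable.\<close>

theorem theorem2p1:
  fixes M :: "'a measure" and X Y :: "'a \<Rightarrow> real"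
    and m n \<alpha>\<^sub>1 \<alpha>\<^sub>2 \<beta>\<^sub>1 \<beta>\<^sub>2 \<gamma>\<^sub>1 \<gamma>\<^sub>2 :: real
  assumes "m > -1/2" and "n > -1/2"
    and "\<bar>\<beta>\<^sub>1\<bar> < \<alpha>\<^sub>1" and "\<bar>\<beta>\<^sub>2\<bar> < \<alpha>\<^sub>2"
    and "\<gamma>\<^sub>1 = sqrt (\<alpha>\<^sub>1\<^sup>2 - \<beta>\<^sub>1\<^sup>2)" and "\<gamma>\<^sub>2 = sqrt (\<alpha>\<^sub>2\<^sup>2 - \<beta>\<^sub>2\<^sup>2)"
    and "prob_space M"
    and "vg_distributed M X m \<alpha>\<^sub>1 \<beta>\<^sub>1" and "vg_distributed M Y n \<alpha>\<^sub>2 \<beta>\<^sub>2"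
    and "prob_space.indep_var M borel X borel Y"
  shows "distributed M lborel (\<lambda>\<omega>. X \<omega> / Y \<omega>)
           (\<lambda>z. ennreal (ratio_density (vg_density m \<alpha>\<^sub>1 \<beta>\<^sub>1) (vg_density n \<alpha>\<^sub>2 \<beta>\<^sub>2) z)) \<and>
    (\<forall>z::real. z \<noteq> 0 \<longrightarrow>
      (let term = (\<lambda>(i::nat, j::nat).
             complex_of_real
               (\<beta>\<^sub>1 ^ i * \<beta>\<^sub>2 ^ j / (fact i * fact j)
                * (2 ^ (i + j) * parity_coeff i j * real_fact (real (i + j) / 2) * z powi (- int j)
                   / (\<alpha>\<^sub>1 ^ (i + j) * Gamma (m + n + 2 + real (i + j))))
                * Gamma (m + n + 1 + real (i + j) / 2)
                * Gamma (m + 1 + real (i + j) / 2)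
                * Gamma (n + 1 + real (i + j) / 2))
             * hyp2F1
                 (complex_of_real (m + n + 1 + real (i + j) / 2))
                 (complex_of_real (n + 1 + real (i + j) / 2))
                 (complex_of_real (m + n + 2 + real (i + j)))
                 (complex_of_real (1 - \<alpha>\<^sub>2\<^sup>2 / (\<alpha>\<^sub>1\<^sup>2 * z\<^sup>2))))
       in term summable_on UNIV \<and>
          complex_of_real (ratio_density (vg_density m \<alpha>\<^sub>1 \<beta>\<^sub>1) (vg_density n \<alpha>\<^sub>2 \<beta>\<^sub>2) z) =
          complex_of_real
            (\<gamma>\<^sub>1 powr (2 * m + 1) * \<gamma>\<^sub>2 powr (2 * n + 1) * \<bar>z\<bar> powr (- 2 * n - 2)
             / (pi * \<alpha>\<^sub>1 powr (2 * m + 2 * n + 2) * Gamma (m + 1/2) * Gamma (n + 1/2)))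
          * infsum term UNIV))"
proof (intro conjI allI impI)
  interpret prob_space M by fact
  show "distributed M lborel (\<lambda>\<omega>. X \<omega> / Y \<omega>)
           (\<lambda>z. ennreal (ratio_density (vg_density m \<alpha>\<^sub>1 \<beta>\<^sub>1) (vg_density n \<alpha>\<^sub>2 \<beta>\<^sub>2) z))"
    using assms unfolding vg_distributed_def
    by (intro distributed_ratio measurable_vg_density vg_density_nonneg)
next
  fix z :: real assume z: "z \<noteq> 0"
  note mn = assms(1,2) and ab = assms(3,4)
  have \<alpha>: "\<alpha>\<^sub>1 > 0" "\<alpha>\<^sub>2 > 0" using ab by linarith+
  define C where "C = \<gamma>\<^sub>1 powr (2 * m + 1) * \<gamma>\<^sub>2 powr (2 * n + 1) * \<bar>z\<bar> powr (- 2 * n - 2)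
             / (pi * \<alpha>\<^sub>1 powr (2 * m + 2 * n + 2) * Gamma (m + 1/2) * Gamma (n + 1/2))"
  define trm where "trm = (\<lambda>(i::nat, j::nat).
             complex_of_real
               (\<beta>\<^sub>1 ^ i * \<beta>\<^sub>2 ^ j / (fact i * fact j)
                * (2 ^ (i + j) * parity_coeff i j * real_fact (real (i + j) / 2) * z powi (- int j)
                   / (\<alpha>\<^sub>1 ^ (i + j) * Gamma (m + n + 2 + real (i + j))))
                * Gamma (m + n + 1 + real (i + j) / 2)
                * Gamma (m + 1 + real (i + j) / 2)
                * Gamma (n + 1 + real (i + j) / 2))
             * hyp2F1
                 (complex_of_real (m + n + 1 + real (i + j) / 2))
                 (complex_of_real (n + 1 + real (i + j) / 2))
                 (complex_of_real (m + n + 2 + real (i + j)))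
                 (complex_of_real (1 - \<alpha>\<^sub>2\<^sup>2 / (\<alpha>\<^sub>1\<^sup>2 * z\<^sup>2))))"
  define K where "K = \<gamma>\<^sub>1 powr (2 * m + 1) * \<gamma>\<^sub>2 powr (2 * n + 1) * \<bar>z\<bar> powr m /
     (pi * (2 * \<alpha>\<^sub>1) powr m * (2 * \<alpha>\<^sub>2) powr n * Gamma (m + 1/2) * Gamma (n + 1/2))"
  \<comment> \<open>Dividing the final sum by \<open>C\<close> requires it to be nonzero; only then
    does summability of \<open>C * trm\<close> pass to \<open>trm\<close>.\<close>
  have "C > 0"
  proof -
    have "\<beta>\<^sub>1\<^sup>2 < \<alpha>\<^sub>1\<^sup>2" "\<beta>\<^sub>2\<^sup>2 < \<alpha>\<^sub>2\<^sup>2"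
      using ab power_strict_mono[of "\<bar>\<beta>\<^sub>1\<bar>" \<alpha>\<^sub>1 2] power_strict_mono[of "\<bar>\<beta>\<^sub>2\<bar>" \<alpha>\<^sub>2 2] by simp_all
    then have "\<gamma>\<^sub>1 > 0" "\<gamma>\<^sub>2 > 0" using assms(5,6) by simp_all
    then show ?thesis
      unfolding C_def using mn z \<alpha>
      by (intro divide_pos_pos mult_pos_pos Gamma_real_pos) auto
  qed
  have "((\<lambda>w. complex_of_real ((\<lambda>(i, j). K * (\<beta>\<^sub>1 ^ i * z ^ i * \<beta>\<^sub>2 ^ j / (fact i * fact j) *
      (LINT y|lborel. besselK_weight m n (\<alpha>\<^sub>1 * \<bar>z\<bar>) \<alpha>\<^sub>2 y * y ^ (i + j)))) w)) has_sum
      complex_of_real (ratio_density (vg_density m \<alpha>\<^sub>1 \<beta>\<^sub>1) (vg_density n \<alpha>\<^sub>2 \<beta>\<^sub>2) z)) UNIV"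
    unfolding K_def assms(5,6) by (intro has_sum_of_real ratio_density_vg_has_sum mn ab z)
  also have "(\<lambda>w. complex_of_real ((\<lambda>(i, j). K * (\<beta>\<^sub>1 ^ i * z ^ i * \<beta>\<^sub>2 ^ j / (fact i * fact j) *
      (LINT y|lborel. besselK_weight m n (\<alpha>\<^sub>1 * \<bar>z\<bar>) \<alpha>\<^sub>2 y * y ^ (i + j)))) w)) = (\<lambda>w. of_real C * trm w)"
  proof
    fix w :: "nat \<times> nat"
    obtain i j where w: "w = (i, j)" by (cases w)
    show "complex_of_real ((\<lambda>(i, j). K * (\<beta>\<^sub>1 ^ i * z ^ i * \<beta>\<^sub>2 ^ j / (fact i * fact j) *
      (LINT y|lborel. besselK_weight m n (\<alpha>\<^sub>1 * \<bar>z\<bar>) \<alpha>\<^sub>2 y * y ^ (i + j)))) w) = of_real C * trm w"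
    proof (cases "even (i + j)")
      \<comment> \<open>Both sides are 0: the odd moment vanishes on the left,
        \<open>parity_coeff\<close> on the right.\<close>
      case False
      then show ?thesis
        unfolding w trm_def prod.case integral_besselK_weight_odd_power[OF False]
        by (simp add: parity_coeff_def)
    next
      case True
      define s where "s = i + j"
      define G where "G = Gamma (1 + s / 2) * Gamma (m + n + 1 + s / 2) * Gamma (m + 1 + s / 2) * Gamma (n + 1 + s / 2) /
          Gamma (m + n + 2 + s)"
      define H where "H = hyp2F1 (complex_of_real (m + n + 1 + real s / 2)) (complex_of_real (n + 1 + real s / 2))
                 (complex_of_real (m + n + 2 + real s)) (complex_of_real (1 - \<alpha>\<^sub>2\<^sup>2 / (\<alpha>\<^sub>1\<^sup>2 * z\<^sup>2)))"
      \<comment> \<open>\<open>q\<close> holds the factors shared by both prefactors together with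
        the Gamma quotient, and \<open>E\<close> the powers in the moment formula. Matching the two
        sides thus reduces to \<open>vg_coefficient_cancel\<close>.\<close>
      define q where "q = \<gamma>\<^sub>1 powr (2 * m + 1) * \<gamma>\<^sub>2 powr (2 * n + 1) / (pi * Gamma (m + 1/2) * Gamma (n + 1/2)) *
         (\<beta>\<^sub>1 ^ i * \<beta>\<^sub>2 ^ j / (fact i * fact j)) * G"
      define E where "E = 2 powr (m + n + s) * (\<alpha>\<^sub>1 * \<bar>z\<bar>) powr (- m - 2 * n - 2 - s) * \<alpha>\<^sub>2 powr n"
      have int: "complex_of_real (LINT y|lborel. besselK_weight m n (\<alpha>\<^sub>1 * \<bar>z\<bar>) \<alpha>\<^sub>2 y * y ^ s) = of_real (E * G) * H"
        using integral_besselK_weight_even_power[of "\<alpha>\<^sub>1 * \<bar>z\<bar>" \<alpha>\<^sub>2 m n s] \<alpha> z mn True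
        by (simp add: E_def G_def H_def s_def power_mult_distrib del: of_real_mult of_real_add of_real_diff of_real_divide of_nat_add)
      have "complex_of_real ((\<lambda>(i, j). K * (\<beta>\<^sub>1 ^ i * z ^ i * \<beta>\<^sub>2 ^ j / (fact i * fact j) *
          (LINT y|lborel. besselK_weight m n (\<alpha>\<^sub>1 * \<bar>z\<bar>) \<alpha>\<^sub>2 y * y ^ (i + j)))) w) =
        of_real (K * (\<beta>\<^sub>1 ^ i * z ^ i * \<beta>\<^sub>2 ^ j / (fact i * fact j)) * (E * G)) * H"
        unfolding w prod.case s_def[symmetric] of_real_mult[of K] of_real_mult[of "_ / _"] int
        by (simp only: of_real_mult mult.assoc)
      also have "K * (\<beta>\<^sub>1 ^ i * z ^ i * \<beta>\<^sub>2 ^ j / (fact i * fact j)) * (E * G) =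
        q * (\<bar>z\<bar> powr m / ((2 * \<alpha>\<^sub>1) powr m * (2 * \<alpha>\<^sub>2) powr n) * z ^ i * E)"
        by (simp add: K_def q_def mult_ac)
      also have "\<dots> = q * (\<bar>z\<bar> powr (- 2 * n - 2) / \<alpha>\<^sub>1 powr (2 * m + 2 * n + 2) * (2 ^ s * z powi (- int j) / \<alpha>\<^sub>1 ^ s))"
        unfolding E_def s_def by (subst vg_coefficient_cancel[OF \<alpha> z True]) (rule refl)
      also have "\<dots> = C * (\<beta>\<^sub>1 ^ i * \<beta>\<^sub>2 ^ j / (fact i * fact j)
                * (2 ^ s * parity_coeff i j * real_fact (real s / 2) * z powi (- int j)
                   / (\<alpha>\<^sub>1 ^ s * Gamma (m + n + 2 + real s)))
                * Gamma (m + n + 1 + real s / 2)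
                * Gamma (m + 1 + real s / 2)
                * Gamma (n + 1 + real s / 2))"
        \<comment> \<open>For even i + j the parity coefficient is 1, and the factor
          \<open>Gamma (1 + s / 2)\<close> from the x-integral is the generalised factorial of
          s/2.\<close>
        using True by (simp add: q_def C_def G_def real_fact_def parity_coeff_def s_def mult_ac add_ac)
      finally show ?thesis
        unfolding w trm_def prod.case s_def[symmetric] H_def[symmetric] by (simp only: of_real_mult mult.assoc)
    qed
  qed
  finally have "(trm has_sum (complex_of_real (ratio_density (vg_density m \<alpha>\<^sub>1 \<beta>\<^sub>1) (vg_density n \<alpha>\<^sub>2 \<beta>\<^sub>2) z) / of_real C)) UNIV"
    using \<open>C > 0\<close> by (subst (asm) has_sum_cmult_right_iff) auto
  then have "trm summable_on UNIV \<and>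
     complex_of_real (ratio_density (vg_density m \<alpha>\<^sub>1 \<beta>\<^sub>1) (vg_density n \<alpha>\<^sub>2 \<beta>\<^sub>2) z) = complex_of_real C * infsum trm UNIV"
    using \<open>C > 0\<close> by (auto simp: summable_on_def dest: infsumI)
  then show "(let term = (\<lambda>(i::nat, j::nat).
             complex_of_real
               (\<beta>\<^sub>1 ^ i * \<beta>\<^sub>2 ^ j / (fact i * fact j)
                * (2 ^ (i + j) * parity_coeff i j * real_fact (real (i + j) / 2) * z powi (- int j)
                   / (\<alpha>\<^sub>1 ^ (i + j) * Gamma (m + n + 2 + real (i + j))))
                * Gamma (m + n + 1 + real (i + j) / 2)
                * Gamma (m + 1 + real (i + j) / 2)
                * Gamma (n + 1 + real (i + j) / 2))
             * hyp2F1
                 (complex_of_real (m + n + 1 + real (i + j) / 2))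
                 (complex_of_real (n + 1 + real (i + j) / 2))
                 (complex_of_real (m + n + 2 + real (i + j)))
                 (complex_of_real (1 - \<alpha>\<^sub>2\<^sup>2 / (\<alpha>\<^sub>1\<^sup>2 * z\<^sup>2))))
       in term summable_on UNIV \<and>
          complex_of_real (ratio_density (vg_density m \<alpha>\<^sub>1 \<beta>\<^sub>1) (vg_density n \<alpha>\<^sub>2 \<beta>\<^sub>2) z) =
          complex_of_real
            (\<gamma>\<^sub>1 powr (2 * m + 1) * \<gamma>\<^sub>2 powr (2 * n + 1) * \<bar>z\<bar> powr (- 2 * n - 2)
             / (pi * \<alpha>\<^sub>1 powr (2 * m + 2 * n + 2) * Gamma (m + 1/2) * Gamma (n + 1/2)))
          * infsum term UNIV)"
    unfolding Let_def C_def trm_def .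
qed

end
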